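(* Assume the standing hypotheses of the context. Let $u$ be an extremizer (a minimizer or a maximizer) of $$\mathcal{J}[u]=\int_{\Delta_n}F\big(t,u(t),\nabla^{\boldsymbol\alpha}_{B_{P^1}}u(t),\nabla^{\boldsymbol\beta}_{K_{P^2}}u(t)\big)\,dt_n\cdots dt_1$$ among all admissible functions (for a given boundary datum $\psi:\partial\Delta_n\to\mathbb{R}^N$), and suppose $u$ satisfies the regularity hypotheses (R) of the context. Then for each $k=1,\dots,N$ and all $t\in\Delta_n$, $$\sum_{i=1}^n\Big[-A^{\alpha_i}_{P^{1*}_{t_i}}\Big(\partial_{v_{k,i}}F\{u\}(t)\Big)+K^{\beta_i}_{P^{2*}_{t_i}}\Big(\partial_{w_{k,i}}F\{u\}(t)\Big)\Big]+\partial_{x_k}F\{u\}(t)=0,$$ where the operators act on the functions $t\mapsto\partial_{v_{k,i}}F\{u\}(t)$ and $t\mapsto\partial_{w_{k,i}}F\{u\}(t)$.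
   Context: Fix $n,N\in\mathbb{N}$, real numbers $a_i<b_i$, $\Delta_n=(a_1,b_1)\times\cdots\times(a_n,b_n)$ with closure $\bar\Delta_n$, $t=(t_1,\dots,t_n)$, $dt=dt_n\cdots dt_1$. For each order $\gamma\in(0,1)$ a kernel $k_\gamma$ is given, assumed to be a difference kernel: $k_\gamma(s,\tau)=k_\gamma(s-\tau)$. A parameter set is $P_{t_i}=\langle a_i,t_i,b_i,p_i,q_i\rangle$ ($p_i,q_i\in\mathbb{R}$), with dual $P^*_{t_i}=\langle a_i,t_i,b_i,q_i,p_i\rangle$. For $f:\bar\Delta_n\to\mathbb{R}$: $K^{\gamma}_{P_{t_i}}f(t)=p_i\int_{a_i}^{t_i}k_\gamma(t_i-\tau)f(t_1,\dots,\tau,\dots,t_n)d\tau+q_i\int_{t_i}^{b_i}k_\gamma(\tau-t_i)f(t_1,\dots,\tau,\dots,t_n)d\tau$ ($\tau$ in the $i$-th slot); $A^{\alpha}_{P_{t_i}}f=\frac{\partial}{\partial t_i}K^{1-\alpha}_{P_{t_i}}f$; $B^{\alpha}_{P_{t_i}}f=K^{1-\alpha}_{P_{t_i}}\frac{\partial f}{\partial t_i}$; operators act componentwise on vector functions. Standing data: $\boldsymbol\alpha=(\alpha_1,\dots,\alpha_n)$, $\boldsymbol\beta=(\beta_1,\dots,\beta_n)\in(0,1)^n$; $P^j=(P^j_{t_1},\dots,P^j_{t_n})$ with $P^j_{t_i}=\langle a_i,t_i,b_i,p^j_i,q^j_i\rangle$, $j=1,2$; $k_{1-\alpha_i},k_{\beta_i}\in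 L_1((0,b_i-a_i);\mathbb{R})$. For $u=(u_1,\dots,u_N):\bar\Delta_n\to\mathbb{R}^N$, $\nabla^{\boldsymbol\alpha}_{B_{P^1}}u$ is the $N\times n$ array with entries $B^{\alpha_i}_{P^1_{t_i}}u_k$ and $\nabla^{\boldsymbol\beta}_{K_{P^2}}u$ the array with entries $K^{\beta_i}_{P^2_{t_i}}u_k$. The Lagrangian $F(t,x,v,w)$, $t\in\bar\Delta_n$, $x\in\mathbb{R}^N$, $v=(v_{k,i}),w=(w_{k,i})\in\mathbb{R}^{N\times n}$, is of class $C^2$; $\partial_{x_k}F,\partial_{v_{k,i}}F,\partial_{w_{k,i}}F$ are its partial derivatives, and $F\{u\}(t)$ denotes evaluation at $(t,u(t),\nabla^{\boldsymbol\alpha}_{B_{P^1}}u(t),\nabla^{\boldsymbol\beta}_{K_{P^2}}u(t))$. A function $u\in C^1(\bar\Delta_n;\mathbb{R}^N)$ is admissible if all $B^{\alpha_i}_{P^1_{t_i}}u$ and $K^{\beta_i}_{P^2_{t_i}}u$ exist and are continuous on $\bar\Delta_n$ and $u=\psi$ on $\partial\Delta_n$. (R): for all $i,k$, $K^{1-\alpha_i}_{P^{1*}_{t_i}}\big(\partial_{v_{k,i}}F\{u\}\big)\in C^1(\bar\Delta_n)$ (so $A^{\alpha_i}_{P^{1*}_{t_i}}(\partial_{v_{k,i}}F\{u\})$ is continuous) and $K^{\beta_i}_{P^{2*}_{t_i}}\big(\partial_{w_{k,i}}F\{u\}\big)$ is continuous on $\bar\Delta_n$. *)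

theory Defs
  imports "HOL-Analysis.Analysis"
begin

text \<open>Points t of the box are vectors real^'n (n = CARD('n)); functions u into R^N are
  real^'n \<Rightarrow> real^'m (N = CARD('m)); N x n arrays are real^'n^'m, entry (k,i) is v$k$i.
  A kernel family is k :: real \<Rightarrow> real \<Rightarrow> real, k gamma s being the difference kernel k_gamma(s).\<close>

definition upd :: "real^'n \<Rightarrow> 'n \<Rightarrow> real \<Rightarrow> real^'n" where
  "upd t i s = (\<chi> j. if j = i then s else t$j)"

definition upd2 :: "real^'n^'m \<Rightarrow> 'm \<Rightarrow> 'n \<Rightarrow> real \<Rightarrow> real^'n^'m" where
  "upd2 v k i s = (\<chi> k'. \<chi> i'. if k' = k \<and> i' = i then s else v$k'$i')"

text \<open>K^gamma_{P_{t_i}} f (t) with P_{t_i} = <a_i,t_i,b_i,p,q>.\<close>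
definition Kop :: "(real \<Rightarrow> real \<Rightarrow> real) \<Rightarrow> real \<Rightarrow> real^'n \<Rightarrow> real^'n \<Rightarrow> real \<Rightarrow> real \<Rightarrow> 'n
    \<Rightarrow> (real^'n \<Rightarrow> real) \<Rightarrow> real^'n \<Rightarrow> real" where
  "Kop k \<gamma> a b p q i f t =
     p * integral {a$i..t$i} (\<lambda>\<tau>. k \<gamma> (t$i - \<tau>) * f (upd t i \<tau>))
   + q * integral {t$i..b$i} (\<lambda>\<tau>. k \<gamma> (\<tau> - t$i) * f (upd t i \<tau>))"

definition Kop_exists :: "(real \<Rightarrow> real \<Rightarrow> real) \<Rightarrow> real \<Rightarrow> real^'n \<Rightarrow> real^'n \<Rightarrow> 'n
    \<Rightarrow> (real^'n \<Rightarrow> real) \<Rightarrow> real^'n \<Rightarrow> bool" where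
  "Kop_exists k \<gamma> a b i f t \<longleftrightarrow>
     (\<lambda>\<tau>. k \<gamma> (t$i - \<tau>) * f (upd t i \<tau>)) integrable_on {a$i..t$i}
   \<and> (\<lambda>\<tau>. k \<gamma> (\<tau> - t$i) * f (upd t i \<tau>)) integrable_on {t$i..b$i}"

definition pd :: "real^'n \<Rightarrow> real^'n \<Rightarrow> 'n \<Rightarrow> (real^'n \<Rightarrow> real) \<Rightarrow> real^'n \<Rightarrow> real" where
  "pd a b i g t = vector_derivative (\<lambda>s. g (upd t i s)) (at (t$i) within {a$i..b$i})"

definition Aop :: "(real \<Rightarrow> real \<Rightarrow> real) \<Rightarrow> real \<Rightarrow> real^'n \<Rightarrow> real^'n \<Rightarrow> real \<Rightarrow> real \<Rightarrow> 'n
    \<Rightarrow> (real^'n \<Rightarrow> real) \<Rightarrow> real^'n \<Rightarrow> real" where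
  "Aop k \<alpha> a b p q i f = pd a b i (Kop k (1 - \<alpha>) a b p q i f)"

definition Bop :: "(real \<Rightarrow> real \<Rightarrow> real) \<Rightarrow> real \<Rightarrow> real^'n \<Rightarrow> real^'n \<Rightarrow> real \<Rightarrow> real \<Rightarrow> 'n
    \<Rightarrow> (real^'n \<Rightarrow> real) \<Rightarrow> real^'n \<Rightarrow> real" where
  "Bop k \<alpha> a b p q i f = Kop k (1 - \<alpha>) a b p q i (pd a b i f)"

definition gradB :: "(real \<Rightarrow> real \<Rightarrow> real) \<Rightarrow> real^'n \<Rightarrow> real^'n \<Rightarrow> real^'n \<Rightarrow> real^'n \<Rightarrow> real^'n
    \<Rightarrow> (real^'n \<Rightarrow> real^'m) \<Rightarrow> real^'n \<Rightarrow> real^'n^'m" where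
  "gradB k \<alpha> a b p q u t = (\<chi> kk. \<chi> i. Bop k (\<alpha>$i) a b (p$i) (q$i) i (\<lambda>s. u s $ kk) t)"

definition gradK :: "(real \<Rightarrow> real \<Rightarrow> real) \<Rightarrow> real^'n \<Rightarrow> real^'n \<Rightarrow> real^'n \<Rightarrow> real^'n \<Rightarrow> real^'n
    \<Rightarrow> (real^'n \<Rightarrow> real^'m) \<Rightarrow> real^'n \<Rightarrow> real^'n^'m" where
  "gradK k \<beta> a b p q u t = (\<chi> kk. \<chi> i. Kop k (\<beta>$i) a b (p$i) (q$i) i (\<lambda>s. u s $ kk) t)"

definition lift :: "(real^'n \<Rightarrow> real^'m \<Rightarrow> real^'n^'m \<Rightarrow> real^'n^'m \<Rightarrow> real)
    \<Rightarrow> (real \<Rightarrow> real \<Rightarrow> real) \<Rightarrow> real^'n \<Rightarrow> real^'n \<Rightarrow> real^'n \<Rightarrow> real^'n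
    \<Rightarrow> real^'n \<Rightarrow> real^'n \<Rightarrow> real^'n \<Rightarrow> real^'n
    \<Rightarrow> (real^'n \<Rightarrow> real^'m) \<Rightarrow> real^'n \<Rightarrow> real" where
  "lift G k \<alpha> \<beta> a b p1 q1 p2 q2 u t =
     G t (u t) (gradB k \<alpha> a b p1 q1 u t) (gradK k \<beta> a b p2 q2 u t)"

definition dxF :: "(real^'n \<Rightarrow> real^'m \<Rightarrow> real^'n^'m \<Rightarrow> real^'n^'m \<Rightarrow> real) \<Rightarrow> 'm
    \<Rightarrow> real^'n \<Rightarrow> real^'m \<Rightarrow> real^'n^'m \<Rightarrow> real^'n^'m \<Rightarrow> real" where
  "dxF F kk t x v w = deriv (\<lambda>s. F t (upd x kk s) v w) (x$kk)"

definition dvF :: "(real^'n \<Rightarrow> real^'m \<Rightarrow> real^'n^'m \<Rightarrow> real^'n^'m \<Rightarrow> real) \<Rightarrow> 'm \<Rightarrow> 'n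
    \<Rightarrow> real^'n \<Rightarrow> real^'m \<Rightarrow> real^'n^'m \<Rightarrow> real^'n^'m \<Rightarrow> real" where
  "dvF F kk i t x v w = deriv (\<lambda>s. F t x (upd2 v kk i s) w) (v$kk$i)"

definition dwF :: "(real^'n \<Rightarrow> real^'m \<Rightarrow> real^'n^'m \<Rightarrow> real^'n^'m \<Rightarrow> real) \<Rightarrow> 'm \<Rightarrow> 'n
    \<Rightarrow> real^'n \<Rightarrow> real^'m \<Rightarrow> real^'n^'m \<Rightarrow> real^'n^'m \<Rightarrow> real" where
  "dwF F kk i t x v w = deriv (\<lambda>s. F t x v (upd2 w kk i s)) (w$kk$i)"

definition C1_on :: "'a::real_normed_vector set \<Rightarrow> ('a \<Rightarrow> 'b::real_normed_vector) \<Rightarrow> bool" where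
  "C1_on S f \<longleftrightarrow> (\<exists>f'. (\<forall>x\<in>S. (f has_derivative blinfun_apply (f' x)) (at x within S))
                       \<and> continuous_on S f')"

definition C2_on :: "'a::real_normed_vector set \<Rightarrow> ('a \<Rightarrow> 'b::real_normed_vector) \<Rightarrow> bool" where
  "C2_on S f \<longleftrightarrow> (\<exists>f' f''. (\<forall>x\<in>S. (f has_derivative blinfun_apply (f' x)) (at x within S))
                       \<and> (\<forall>x\<in>S. (f' has_derivative blinfun_apply (f'' x)) (at x within S))
                       \<and> continuous_on S f'')"

definition admissible :: "(real \<Rightarrow> real \<Rightarrow> real) \<Rightarrow> real^'n \<Rightarrow> real^'n \<Rightarrow> real^'n \<Rightarrow> real^'n
    \<Rightarrow> real^'n \<Rightarrow> real^'n \<Rightarrow> real^'n \<Rightarrow> real^'n \<Rightarrow> (real^'n \<Rightarrow> real^'m) \<Rightarrow> (real^'n \<Rightarrow> real^'m) \<Rightarrow> bool" where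
  "admissible k \<alpha> \<beta> a b p1 q1 p2 q2 \<psi> u \<longleftrightarrow>
     C1_on (cbox a b) u
   \<and> (\<forall>kk i.
        (\<forall>t\<in>cbox a b. Kop_exists k (1 - \<alpha>$i) a b i (pd a b i (\<lambda>s. u s $ kk)) t
                     \<and> Kop_exists k (\<beta>$i) a b i (\<lambda>s. u s $ kk) t)
      \<and> continuous_on (cbox a b) (Bop k (\<alpha>$i) a b (p1$i) (q1$i) i (\<lambda>s. u s $ kk))
      \<and> continuous_on (cbox a b) (Kop k (\<beta>$i) a b (p2$i) (q2$i) i (\<lambda>s. u s $ kk)))
   \<and> (\<forall>t\<in>frontier (cbox a b). u t = \<psi> t)"

definition Jfun :: "(real^'n \<Rightarrow> real^'m \<Rightarrow> real^'n^'m \<Rightarrow> real^'n^'m \<Rightarrow> real)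
    \<Rightarrow> (real \<Rightarrow> real \<Rightarrow> real) \<Rightarrow> real^'n \<Rightarrow> real^'n \<Rightarrow> real^'n \<Rightarrow> real^'n
    \<Rightarrow> real^'n \<Rightarrow> real^'n \<Rightarrow> real^'n \<Rightarrow> real^'n \<Rightarrow> (real^'n \<Rightarrow> real^'m) \<Rightarrow> real" where
  "Jfun F k \<alpha> \<beta> a b p1 q1 p2 q2 u = integral (box a b) (lift F k \<alpha> \<beta> a b p1 q1 p2 q2 u)"

end

theory Submission
  imports Defs
begin

text \<open>Perturbing the extremizer by \<open>\<epsilon> \<eta>\<close> in the \<open>k\<close>-th component and differentiating
  under the integral gives
  \<open>\<integral> \<partial>\<^sub>x F \<eta> + \<Sum>\<^sub>i \<partial>\<^sub>v F K (\<partial>\<^sub>i \<eta>) + \<Sum>\<^sub>i \<partial>\<^sub>w F K \<eta> = 0\<close>.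
  After extension by zero, \<open>K\<close> is an integral of translates weighted by an \<open>L\<^sub>1\<close> kernel, so Fubini and
  translation invariance of Lebesgue measure move it to the other factor with \<open>p\<close> and \<open>q\<close> swapped.
  Integration by parts then frees \<open>\<eta>\<close>, and since the resulting Euler--Lagrange expression is continuous
  it suffices to test it against the radial \<open>C\<^sup>1\<close> bumps \<open>(max 0 (r\<^sup>2 - |t - t\<^sub>0|\<^sup>2))\<^sup>2\<close>.\<close>

subsection \<open>The operator \<open>K\<close> as a convolution\<close>

text \<open>Extension by zero allows translates to be taken anywhere in space. The moving limits of
  the two integrals in \<open>Kop\<close> then disappear into the integrand, because a shifted point
  contributes nothing once it leaves the box.\<close>

definition zero_ext :: "'a set \<Rightarrow> ('a \<Rightarrow> real) \<Rightarrow> 'a \<Rightarrow> real" where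
  "zero_ext S f x = (if x \<in> S then f x else 0)"

lemma zero_ext_in [simp]: "x \<in> S \<Longrightarrow> zero_ext S f x = f x"
  and zero_ext_out [simp]: "x \<notin> S \<Longrightarrow> zero_ext S f x = 0"
  by (auto simp: zero_ext_def)

lemma borel_measurable_zero_ext:
  fixes f :: "'a::euclidean_space \<Rightarrow> real"
  assumes "continuous_on (cbox a b) f"
  shows "zero_ext (cbox a b) f \<in> borel_measurable borel"
  unfolding zero_ext_def
  by (rule borel_measurable_continuous_on_if) (use assms in auto)

lemma bounded_zero_ext:
  fixes f :: "'a::euclidean_space \<Rightarrow> real"
  assumes "continuous_on (cbox a b) f"
  obtains M where "\<And>x. \<bar>zero_ext (cbox a b) f x\<bar> \<le> M"
proof -
  have "bounded (f ` cbox a b)"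
    using assms compact_cbox compact_continuous_image compact_imp_bounded by blast
  then obtain M where M: "\<And>x. x \<in> cbox a b \<Longrightarrow> \<bar>f x\<bar> \<le> M"
    by (auto simp: bounded_iff)
  have "\<bar>zero_ext (cbox a b) f x\<bar> \<le> max 0 M" for x
    using M[of x] by (auto simp: zero_ext_def)
  with that show ?thesis by blast
qed

lemma zero_ext_eq_self:
  assumes "\<And>x. x \<notin> S \<Longrightarrow> f x = 0"
  shows "zero_ext S f = f"
  using assms by (auto simp: zero_ext_def)

text \<open>Integrability of the kernel concerns Lebesgue measurable functions, whereas Fubini on
  \<open>lborel\<close> asks for a Borel function of \<open>(t, s)\<close>. A Borel representative
  of the kernel cut off to \<open>{0<..<L}\<close> bridges the two, and the cut-off lets integrals
  over \<open>s\<close> run over the whole line.\<close>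

lemma borel_kernel_exists:
  fixes h :: "real \<Rightarrow> real"
  assumes "h absolutely_integrable_on {0<..<L}"
  obtains \<kappa> where "integrable lborel \<kappa>"
    "AE s in lborel. \<kappa> s = indicator {0<..<L} s * h s"
proof -
  have int: "integrable lebesgue (\<lambda>s. indicator {0<..<L} s * h s)" (is "integrable _ ?h")
    using assms by (simp add: set_integrable_def)
  then obtain \<kappa> where \<kappa>: "\<kappa> \<in> borel_measurable lborel" "AE s in lborel. ?h s = \<kappa> s"
    using completion_ex_borel_measurable_real[of ?h lborel] by auto
  have ae: "AE s in lebesgue. ?h s = \<kappa> s"
    using \<kappa>(2) by (rule AE_completion)
  have "integrable lebesgue \<kappa>"
    using int by (subst integrable_cong_AE[OF _ _ ae, symmetric])
      (use measurable_completion[OF \<kappa>(1)] int in \<open>auto dest: borel_measurable_integrable\<close>)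
  then have "integrable lborel \<kappa>"
    using \<kappa>(1) by (simp add: integrable_completion)
  moreover have "AE s in lborel. \<kappa> s = ?h s"
    using \<kappa>(2) by (auto elim: eventually_mono)
  ultimately show ?thesis using that \<kappa>(1) by auto
qed

section \<open>Weighted integrals of translates on the whole space\<close>

lemma integrable_mult_shift:
  fixes \<kappa> :: "real \<Rightarrow> real" and g :: "'a::euclidean_space \<Rightarrow> real"
  assumes \<kappa>: "integrable lborel \<kappa>" and g: "g \<in> borel_measurable borel"
    and M: "\<And>x. \<bar>g x\<bar> \<le> M"
  shows "integrable lborel (\<lambda>s. \<kappa> s * g (t + s *\<^sub>R e))"
proof (rule Bochner_Integration.integrable_bound)
  show "integrable lborel (\<lambda>s. \<bar>\<kappa> s\<bar> * M)"
    using \<kappa> by auto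
  show "(\<lambda>s. \<kappa> s * g (t + s *\<^sub>R e)) \<in> borel_measurable lborel"
    using \<kappa> g by measurable
  show "AE s in lborel. norm (\<kappa> s * g (t + s *\<^sub>R e)) \<le> norm (\<bar>\<kappa> s\<bar> * M)"
    using M by (auto simp: abs_mult intro!: mult_left_mono order_trans[OF M])
qed

lemma lborel_integral_translate:
  fixes h :: "'a::euclidean_space \<Rightarrow> real"
  assumes "h \<in> borel_measurable borel"
  shows "(\<integral>x. h (c + x) \<partial>lborel) = (\<integral>x. h x \<partial>lborel)"
proof -
  have "(\<integral>x. h x \<partial>lborel) = (\<integral>x. h x \<partial>distr lborel borel (\<lambda>x. c + x))"
    by (simp add: lborel_distr_plus)
  also have "\<dots> = (\<integral>x. h (c + x) \<partial>lborel)"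
    using assms by (intro integral_distr) auto
  finally show ?thesis by simp
qed

text \<open>Exchanging the order of integration leaves, for each fixed \<open>s\<close>, an integral
  over all of space. Translating it by \<open>s *\<^sub>R e\<close> moves the shift from
  \<open>f\<close> to \<open>g\<close> and reverses its direction; this reversal is what later
  interchanges \<open>p\<close> and \<open>q\<close>. The second conclusion allows the two halves of
  \<open>Kop\<close> to be integrated separately.\<close>

lemma convolution_adjoint:
  fixes \<kappa> :: "real \<Rightarrow> real" and f g :: "'a::euclidean_space \<Rightarrow> real"
  assumes \<kappa>: "integrable lborel \<kappa>"
    and f: "f \<in> borel_measurable borel" "\<And>x. \<bar>f x\<bar> \<le> M"
    and g: "g \<in> borel_measurable borel" "\<And>x. \<bar>g x\<bar> \<le> N"
    and f0: "\<And>x. x \<notin> cbox a b \<Longrightarrow> f x = 0" and g0: "\<And>x. x \<notin> cbox a b \<Longrightarrow> g x = 0"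
  shows "(\<integral>t. g t * (\<integral>s. \<kappa> s * f (t + s *\<^sub>R e) \<partial>lborel) \<partial>lborel) =
         (\<integral>t. f t * (\<integral>s. \<kappa> s * g (t + s *\<^sub>R (- e)) \<partial>lborel) \<partial>lborel)"
    and "integrable lborel (\<lambda>t. g t * (\<integral>s. \<kappa> s * f (t + s *\<^sub>R e) \<partial>lborel))"
proof -
  note [measurable] = f(1) g(1)
  have [measurable]: "\<kappa> \<in> borel_measurable borel" using \<kappa> by auto
  \<comment> \<open>Stated for arbitrary functions and directions, since Fubini is applied before
    and after the translation with the roles of \<open>f\<close> and \<open>g\<close>
    exchanged.\<close>
  have prod: "integrable (lborel \<Otimes>\<^sub>M lborel) (\<lambda>(t, s). g t * (\<kappa> s * f (t + s *\<^sub>R e)))"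
    (is "integrable _ ?H")
    if "g \<in> borel_measurable borel" "\<And>x. \<bar>g x\<bar> \<le> N" "f \<in> borel_measurable borel" "\<And>x. \<bar>f x\<bar> \<le> M"
      "\<And>x. x \<notin> cbox a b \<Longrightarrow> g x = 0" for f g :: "'a \<Rightarrow> real" and N M and e :: 'a
  proof (rule Bochner_Integration.integrable_bound)
    note [measurable] = that(1,3)
    \<comment> \<open>The majorant factorizes: the outer function is bounded and lives on the box,
      which controls \<open>t\<close>, while the kernel controls \<open>s\<close>.\<close>
    let ?D = "\<lambda>(t, s). (indicator (cbox a b) t :: real) * (\<bar>\<kappa> s\<bar> * (N * M))"
    show "integrable (lborel \<Otimes>\<^sub>M lborel) ?D"
    proof (rule lborel_pair.Fubini_integrable)
      show "?D \<in> borel_measurable (lborel \<Otimes>\<^sub>M lborel)" by measurable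
      have "integrable lborel (indicator (cbox a b) :: 'a \<Rightarrow> real)"
        by (intro integrable_real_indicator) (auto simp: emeasure_lborel_cbox_eq)
      then show "integrable lborel (\<lambda>t. \<integral>s. norm (?D (t, s)) \<partial>lborel)"
        by (simp add: abs_mult)
      show "AE t in lborel. integrable lborel (\<lambda>s. ?D (t, s))"
        using \<kappa> by auto
    qed
    show "?H \<in> borel_measurable (lborel \<Otimes>\<^sub>M lborel)" by measurable
    have "norm (?H x) \<le> norm (?D x)" for x
    proof -
      obtain t s where x: "x = (t, s)" by (cases x)
      have "\<bar>g t\<bar> * (\<bar>\<kappa> s\<bar> * \<bar>f (t + s *\<^sub>R e)\<bar>) \<le> N * (\<bar>\<kappa> s\<bar> * M)"
        using that(2)[of t] that(4)[of "t + s *\<^sub>R e"] by (intro mult_mono) auto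
      also have "\<dots> \<le> \<bar>\<kappa> s\<bar> * (\<bar>N\<bar> * \<bar>M\<bar>)"
        by (metis abs_ge_self abs_mult mult.left_commute mult_left_mono abs_ge_zero)
      finally show ?thesis
        using that(5)[of t] by (cases "t \<in> cbox a b") (auto simp: x abs_mult)
    qed
    then show "AE x in lborel \<Otimes>\<^sub>M lborel. norm (?H x) \<le> norm (?D x)" by auto
  qed
  have pg: "integrable (lborel \<Otimes>\<^sub>M lborel) (\<lambda>(t, s). g t * (\<kappa> s * f (t + s *\<^sub>R e)))"
    by (rule prod[OF g f g0])
  have pf: "integrable (lborel \<Otimes>\<^sub>M lborel) (\<lambda>(t, s). f t * (\<kappa> s * g (t + s *\<^sub>R (-e))))"
    by (rule prod[OF f g f0])
  have "(\<integral>t. g t * (\<integral>s. \<kappa> s * f (t + s *\<^sub>R e) \<partial>lborel) \<partial>lborel) =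
        (\<integral>s. \<integral>t. g t * (\<kappa> s * f (t + s *\<^sub>R e)) \<partial>lborel \<partial>lborel)"
    using lborel_pair.Fubini_integral[OF pg] by simp
  also have "\<dots> = (\<integral>s. \<integral>t. f t * (\<kappa> s * g (t + s *\<^sub>R (- e))) \<partial>lborel \<partial>lborel)"
  proof (rule Bochner_Integration.integral_cong[OF refl])
    fix s
    \<comment> \<open>The substitution puts \<open>s *\<^sub>R e + t\<close> for \<open>t\<close>,
      which cancels the backward shift inside \<open>g\<close>.\<close>
    have "(\<integral>t. f t * (\<kappa> s * g (t + s *\<^sub>R (- e))) \<partial>lborel) =
       (\<integral>t. f (s *\<^sub>R e + t) * (\<kappa> s * g ((s *\<^sub>R e + t) + s *\<^sub>R (- e))) \<partial>lborel)"
      by (rule lborel_integral_translate[symmetric]) measurable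
    from this[symmetric] show "(\<integral>t. g t * (\<kappa> s * f (t + s *\<^sub>R e)) \<partial>lborel) =
       (\<integral>t. f t * (\<kappa> s * g (t + s *\<^sub>R (- e))) \<partial>lborel)"
      by (simp add: algebra_simps)
  qed
  also have "\<dots> = (\<integral>t. f t * (\<integral>s. \<kappa> s * g (t + s *\<^sub>R (- e)) \<partial>lborel) \<partial>lborel)"
    using lborel_pair.Fubini_integral[OF pf] by simp
  finally show "(\<integral>t. g t * (\<integral>s. \<kappa> s * f (t + s *\<^sub>R e) \<partial>lborel) \<partial>lborel) =
         (\<integral>t. f t * (\<integral>s. \<kappa> s * g (t + s *\<^sub>R (- e)) \<partial>lborel) \<partial>lborel)" .
  show "integrable lborel (\<lambda>t. g t * (\<integral>s. \<kappa> s * f (t + s *\<^sub>R e) \<partial>lborel))"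
    using lborel_pair.integrable_fst[OF pg] by simp
qed

section \<open>Transfer of the whole-space results to \<open>Kop\<close> on the box\<close>

lemma upd_eq: "upd t i s = t + (s - t$i) *\<^sub>R axis i 1"
  by (auto simp: upd_def vec_eq_iff axis_def)

lemma shift_mem_cbox_iff:
  fixes t :: "real^'n"
  assumes "t \<in> cbox a b"
  shows "t + s *\<^sub>R axis i 1 \<in> cbox a b \<longleftrightarrow> a$i \<le> t$i + s \<and> t$i + s \<le> b$i"
  using assms by (auto simp: mem_box_cart axis_def split: if_splits)

text \<open>With \<open>s = t$i - \<tau>\<close> in one integral and \<open>s = \<tau> - t$i\<close>
  in the other, both run over a distance \<open>s\<close> against the same kernel, in the directions
  \<open>- axis i 1\<close> and \<open>axis i 1\<close>. The zero extension reproduces the limits,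
  since the shifted point leaves the box at distance \<open>t$i - a$i\<close> or
  \<open>b$i - t$i\<close>.\<close>

lemma kernel_has_integral:
  fixes t :: "real^'n"
  assumes t: "t \<in> cbox a b"
    and \<kappa>: "integrable lborel \<kappa>" "AE s in lborel. \<kappa> s = indicator {0<..<b$i - a$i} s * h s"
    and f: "continuous_on (cbox a b) f"
  shows "((\<lambda>\<tau>. h (t$i - \<tau>) * f (upd t i \<tau>)) has_integral
           (\<integral>s. \<kappa> s * zero_ext (cbox a b) f (t + s *\<^sub>R (- axis i 1)) \<partial>lborel)) {a$i..t$i}"
    and "((\<lambda>\<tau>. h (\<tau> - t$i) * f (upd t i \<tau>)) has_integral
           (\<integral>s. \<kappa> s * zero_ext (cbox a b) f (t + s *\<^sub>R axis i 1) \<partial>lborel)) {t$i..b$i}"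
proof -
  obtain M where M: "\<And>x. \<bar>zero_ext (cbox a b) f x\<bar> \<le> M"
    using bounded_zero_ext[OF f] by metis
  note int = integrable_mult_shift[OF \<kappa>(1) borel_measurable_zero_ext[OF f] M]
  have at: "a$i \<le> t$i" "t$i \<le> b$i"
    using t by (auto simp: mem_box_cart)
  \<comment> \<open>\<open>\<kappa>\<close> represents the kernel cut off to an open interval, while
    the target interval \<open>{0..d}\<close> is closed; the possible mismatches at the endpoints
    form a null set.\<close>
  have ae: "AE s in lborel. s \<noteq> 0 \<and> s \<noteq> b$i - a$i"
    using AE_lborel_singleton[of "0::real"] AE_lborel_singleton[of "b$i - a$i"] by eventually_elim auto
  \<comment> \<open>Here \<open>d\<close> stands for the distance from \<open>t\<close> to the face
    of the box in direction \<open>e\<close>, so one argument serves both halves of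
    \<open>Kop\<close>.\<close>
  have key: "((\<lambda>s. h s * f (t + s *\<^sub>R e)) has_integral
      (\<integral>s. \<kappa> s * zero_ext (cbox a b) f (t + s *\<^sub>R e) \<partial>lborel)) {0..d}"
    if d: "\<And>s. s > 0 \<Longrightarrow> s < b$i - a$i \<Longrightarrow> t + s *\<^sub>R e \<in> cbox a b \<longleftrightarrow> s \<le> d"
      "d \<le> b$i - a$i" for d e
  proof -
    have "((\<lambda>s. \<kappa> s * zero_ext (cbox a b) f (t + s *\<^sub>R e)) has_integral
      (\<integral>s. \<kappa> s * zero_ext (cbox a b) f (t + s *\<^sub>R e) \<partial>lborel)) UNIV"
      by (rule has_integral_integral_lborel[OF int])
    moreover have "AE s in lborel. s \<in> UNIV \<longrightarrow> \<kappa> s * zero_ext (cbox a b) f (t + s *\<^sub>R e) =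
        (if s \<in> {0..d} then h s * f (t + s *\<^sub>R e) else 0)"
      using \<kappa>(2) ae
    proof eventually_elim
      case (elim s)
      then show ?case
        using d(1)[of s] d(2) by (auto simp: indicator_def zero_ext_def)
    qed
    ultimately have "((\<lambda>s. if s \<in> {0..d} then h s * f (t + s *\<^sub>R e) else 0) has_integral
      (\<integral>s. \<kappa> s * zero_ext (cbox a b) f (t + s *\<^sub>R e) \<partial>lborel)) UNIV"
      by (subst (asm) has_integral_AE) auto
    then show ?thesis by (simp only: has_integral_restrict_UNIV)
  qed
  have "((\<lambda>s. h s * f (t + s *\<^sub>R (- axis i 1))) has_integral
      (\<integral>s. \<kappa> s * zero_ext (cbox a b) f (t + s *\<^sub>R (- axis i 1)) \<partial>lborel)) (cbox 0 (t$i - a$i))"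
    unfolding box_real
    by (rule key) (use shift_mem_cbox_iff[OF t, of "- s" i for s] at in \<open>simp_all add: le_diff_eq add.commute\<close>)
  from has_integral_affinity[OF this, of "-1" "t$i"]
  show "((\<lambda>\<tau>. h (t$i - \<tau>) * f (upd t i \<tau>)) has_integral
      (\<integral>s. \<kappa> s * zero_ext (cbox a b) f (t + s *\<^sub>R (- axis i 1)) \<partial>lborel)) {a$i..t$i}"
    using at unfolding image_affinity_cbox by (simp add: upd_eq algebra_simps)
  have "((\<lambda>s. h s * f (t + s *\<^sub>R (axis i 1))) has_integral
      (\<integral>s. \<kappa> s * zero_ext (cbox a b) f (t + s *\<^sub>R (axis i 1)) \<partial>lborel)) (cbox 0 (b$i - t$i))"
    unfolding box_real
    by (rule key) (use shift_mem_cbox_iff[OF t] at in \<open>simp_all add: le_diff_eq add.commute\<close>)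
  from has_integral_affinity[OF this, of "1" "-t$i"]
  show "((\<lambda>\<tau>. h (\<tau> - t$i) * f (upd t i \<tau>)) has_integral
      (\<integral>s. \<kappa> s * zero_ext (cbox a b) f (t + s *\<^sub>R (axis i 1)) \<partial>lborel)) {t$i..b$i}"
    using at unfolding image_affinity_cbox by (simp add: upd_eq algebra_simps)
qed

lemma Kop_exists_continuous:
  fixes t :: "real^'n"
  assumes "k \<gamma> absolutely_integrable_on {0<..<b$i - a$i}" "continuous_on (cbox a b) f" "t \<in> cbox a b"
  shows "Kop_exists k \<gamma> a b i f t"
proof -
  obtain \<kappa> where \<kappa>: "integrable lborel \<kappa>"
      "AE s in lborel. \<kappa> s = indicator {0<..<b$i - a$i} s * k \<gamma> s"
    using borel_kernel_exists[OF assms(1)] by metis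
  show ?thesis
    using kernel_has_integral[OF assms(3) \<kappa> assms(2)] unfolding Kop_exists_def by blast
qed

lemma Kop_eq_convolution:
  fixes t :: "real^'n"
  assumes "t \<in> cbox a b" "integrable lborel \<kappa>"
    "AE s in lborel. \<kappa> s = indicator {0<..<b$i - a$i} s * k \<gamma> s" "continuous_on (cbox a b) f"
  shows "Kop k \<gamma> a b p q i f t =
      p * (\<integral>s. \<kappa> s * zero_ext (cbox a b) f (t + s *\<^sub>R (- axis i 1)) \<partial>lborel)
    + q * (\<integral>s. \<kappa> s * zero_ext (cbox a b) f (t + s *\<^sub>R axis i 1) \<partial>lborel)"
  using kernel_has_integral[OF assms] unfolding Kop_def by (simp add: integral_unique)

text \<open>Dominated convergence: since \<open>f\<close> is bounded,
  \<open>\<bar>\<kappa> s\<bar> * M\<close> majorizes the integrand for every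
  \<open>t\<close>.\<close>

lemma continuous_convolution:
  fixes f :: "'a::euclidean_space \<Rightarrow> real"
  assumes \<kappa>: "integrable lborel \<kappa>" and f: "continuous_on UNIV f" and M: "\<And>x. \<bar>f x\<bar> \<le> M"
  shows "continuous_on UNIV (\<lambda>t. \<integral>s. \<kappa> s * f (t + s *\<^sub>R e) \<partial>lborel)"
  unfolding continuous_on_sequentially
proof (intro allI ballI impI)
  fix x :: "nat \<Rightarrow> 'a" and t
  assume "(\<forall>n. x n \<in> UNIV) \<and> x \<longlonglongrightarrow> t"
  then have x: "x \<longlonglongrightarrow> t" by simp
  have [measurable]: "f \<in> borel_measurable borel" "\<kappa> \<in> borel_measurable borel"
    using f \<kappa> by (auto intro: borel_measurable_continuous_onI)
  show "((\<lambda>t. \<integral>s. \<kappa> s * f (t + s *\<^sub>R e) \<partial>lborel) \<circ> x) \<longlonglongrightarrow> (\<integral>s. \<kappa> s * f (t + s *\<^sub>R e) \<partial>lborel)"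
    unfolding o_def
  proof (rule integral_dominated_convergence)
    show "integrable lborel (\<lambda>s. \<bar>\<kappa> s\<bar> * M)" using \<kappa> by auto
    have "(\<lambda>n. \<kappa> s * f (x n + s *\<^sub>R e)) \<longlonglongrightarrow> \<kappa> s * f (t + s *\<^sub>R e)" for s
      by (intro tendsto_mult tendsto_const continuous_on_tendsto_compose[OF f] tendsto_add x) auto
    then show "AE s in lborel. (\<lambda>n. \<kappa> s * f (x n + s *\<^sub>R e)) \<longlonglongrightarrow> \<kappa> s * f (t + s *\<^sub>R e)"
      by simp
    show "AE s in lborel. norm (\<kappa> s * f (x n + s *\<^sub>R e)) \<le> \<bar>\<kappa> s\<bar> * M" for n
      using M by (auto simp: abs_mult intro!: mult_left_mono)
  qed measurable
qed

text \<open>A continuous function that vanishes off the box is its own zero extension, so no jump at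
  the boundary spoils continuity of the convolution. Bumps and their partial derivatives are of this
  kind, which keeps the perturbed functions admissible.\<close>

lemma continuous_on_Kop:
  fixes f :: "real^'n \<Rightarrow> real"
  assumes k: "k \<gamma> absolutely_integrable_on {0<..<b$i - a$i}"
    and f: "continuous_on UNIV f" and f0: "\<And>x. x \<notin> cbox a b \<Longrightarrow> f x = 0"
  shows "continuous_on (cbox a b) (Kop k \<gamma> a b p q i f)"
proof -
  obtain \<kappa> where \<kappa>: "integrable lborel \<kappa>"
      "AE s in lborel. \<kappa> s = indicator {0<..<b$i - a$i} s * k \<gamma> s"
    using borel_kernel_exists[OF k] by metis
  have f': "continuous_on (cbox a b) f" using f continuous_on_subset by blast
  have z: "zero_ext (cbox a b) f = f" by (rule zero_ext_eq_self[OF f0])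
  obtain M where M: "\<And>x. \<bar>f x\<bar> \<le> M"
    using bounded_zero_ext[OF f'] unfolding z by metis
  note c = continuous_on_subset[OF continuous_convolution[OF \<kappa>(1) f M] subset_UNIV]
  have "continuous_on (cbox a b) (\<lambda>t. p * (\<integral>s. \<kappa> s * f (t + s *\<^sub>R (- axis i 1)) \<partial>lborel)
      + q * (\<integral>s. \<kappa> s * f (t + s *\<^sub>R axis i 1) \<partial>lborel))"
    by (intro continuous_on_add continuous_on_mult continuous_on_const c)
  then show ?thesis
    by (rule continuous_on_eq) (simp only: Kop_eq_convolution[where k = k and \<gamma> = \<gamma>, OF _ \<kappa> f'] z)
qed

text \<open>Passes from the gauge integral over a box to the Lebesgue integral over space, where
  Fubini and translation invariance apply.\<close>

lemma integral_cbox_eq_lborel: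
  fixes h :: "'a::euclidean_space \<Rightarrow> real"
  assumes h: "continuous_on (cbox a b) h" and g: "\<And>t. t \<in> cbox a b \<Longrightarrow> g t = h t"
    "\<And>t. t \<notin> cbox a b \<Longrightarrow> g t = 0"
  shows "integral (cbox a b) h = (\<integral>t. g t \<partial>lborel)"
proof -
  have "set_integrable lborel (cbox a b) h"
    unfolding set_integrable_def using borel_integrable_compact[OF compact_cbox h]
    by (rule Bochner_Integration.integrable_cong[THEN iffD1, rotated -1]) (auto simp: indicator_def)
  from set_borel_integral_eq_integral(2)[OF this]
  have "integral (cbox a b) h = (LINT t : cbox a b | lborel. h t)" by simp
  also have "\<dots> = (\<integral>t. g t \<partial>lborel)"
    unfolding set_lebesgue_integral_def
    by (rule Bochner_Integration.integral_cong) (use g in \<open>auto simp: indicator_def\<close>)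
  finally show ?thesis .
qed

text \<open>Fractional integration by parts with the dual parameter set. The \<open>p\<close> half
  of \<open>Kop\<close> shifts by \<open>- axis i 1\<close>; its adjoint shifts by
  \<open>axis i 1\<close>, which is the \<open>q\<close> half, so the weights trade places.
  Continuity of both images makes the two products continuous, so that their box integrals are
  Lebesgue integrals.\<close>

lemma Kop_adjoint:
  fixes f g :: "real^'n \<Rightarrow> real"
  assumes k: "k \<gamma> absolutely_integrable_on {0<..<b$i - a$i}"
    and f: "continuous_on (cbox a b) f" and g: "continuous_on (cbox a b) g"
    and Kf: "continuous_on (cbox a b) (Kop k \<gamma> a b p q i f)"
    and Kg: "continuous_on (cbox a b) (Kop k \<gamma> a b q p i g)"
  shows "integral (cbox a b) (\<lambda>t. g t * Kop k \<gamma> a b p q i f t) =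
         integral (cbox a b) (\<lambda>t. Kop k \<gamma> a b q p i g t * f t)"
proof -
  obtain \<kappa> where \<kappa>: "integrable lborel \<kappa>"
      "AE s in lborel. \<kappa> s = indicator {0<..<b$i - a$i} s * k \<gamma> s"
    using borel_kernel_exists[OF k] by metis
  define C where "C = (\<lambda>h t (e :: real^'n). \<integral>s. \<kappa> s * zero_ext (cbox a b) h (t + s *\<^sub>R e) \<partial>lborel)"
  let ?z = "zero_ext (cbox a b)"
  let ?e = "axis i 1 :: real^'n"
  obtain M where M: "\<And>x. \<bar>?z f x\<bar> \<le> M" using bounded_zero_ext[OF f] by metis
  obtain N where N: "\<And>x. \<bar>?z g x\<bar> \<le> N" using bounded_zero_ext[OF g] by metis
  note mf = borel_measurable_zero_ext[OF f] and mg = borel_measurable_zero_ext[OF g]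
  have ad: "(\<integral>t. ?z g t * C f t e \<partial>lborel) = (\<integral>t. ?z f t * C g t (- e) \<partial>lborel)"
    and ig: "integrable lborel (\<lambda>t. ?z g t * C f t e)"
    and ifc: "integrable lborel (\<lambda>t. ?z f t * C g t e)" for e
    unfolding C_def
    by (rule convolution_adjoint[OF \<kappa>(1) mf M mg N, of a b] convolution_adjoint[OF \<kappa>(1) mg N mf M, of a b];
        simp)+
  have "integral (cbox a b) (\<lambda>t. g t * Kop k \<gamma> a b p q i f t) =
        (\<integral>t. p * (?z g t * C f t (- ?e)) + q * (?z g t * C f t ?e) \<partial>lborel)"
    by (rule integral_cbox_eq_lborel[OF continuous_on_mult[OF g Kf]])
      (simp_all add: Kop_eq_convolution[where k = k and \<gamma> = \<gamma>, OF _ \<kappa> f]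
        C_def distrib_left mult_ac)
  also have "\<dots> = p * (\<integral>t. ?z g t * C f t (- ?e) \<partial>lborel) + q * (\<integral>t. ?z g t * C f t ?e \<partial>lborel)"
    using ig by (subst Bochner_Integration.integral_add) auto
  also have "\<dots> = p * (\<integral>t. ?z f t * C g t ?e \<partial>lborel) + q * (\<integral>t. ?z f t * C g t (- ?e) \<partial>lborel)"
    using ad[of ?e] ad[of "- ?e"] by simp
  also have "\<dots> = (\<integral>t. p * (?z f t * C g t ?e) + q * (?z f t * C g t (- ?e)) \<partial>lborel)"
    using ifc by (subst Bochner_Integration.integral_add) auto
  also have "\<dots> = integral (cbox a b) (\<lambda>t. Kop k \<gamma> a b q p i g t * f t)"
    by (rule integral_cbox_eq_lborel[OF continuous_on_mult[OF Kg f], symmetric])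
      (simp_all add: Kop_eq_convolution[where k = k and \<gamma> = \<gamma>, OF _ \<kappa> g]
        C_def distrib_left mult_ac)
  finally show ?thesis .
qed

lemma upd_mem_cbox:
  fixes t :: "real^'n"
  assumes "t \<in> cbox a b" "s \<in> {a$i..b$i}"
  shows "upd t i s \<in> cbox a b"
  using assms by (auto simp: mem_box_cart upd_def)

text \<open>Agreement is required on the box alone, because the partial derivatives of a perturbed
  function are computed only there; the points \<open>upd t i \<tau>\<close> stay in the box over
  both ranges of integration.\<close>

lemma Kop_add_scaled:
  fixes t :: "real^'n"
  assumes t: "t \<in> cbox a b" and ex: "Kop_exists k \<gamma> a b i f t" "Kop_exists k \<gamma> a b i g t"
    and h: "\<And>s. s \<in> cbox a b \<Longrightarrow> h s = f s + c * g s"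
  shows "Kop_exists k \<gamma> a b i h t"
    and "Kop k \<gamma> a b p q i h t = Kop k \<gamma> a b p q i f t + c * Kop k \<gamma> a b p q i g t"
proof -
  have at: "a$i \<le> t$i" "t$i \<le> b$i" using t by (auto simp: mem_box_cart)
  define I where "I = (\<lambda>f. integral {a$i..t$i} (\<lambda>\<tau>. k \<gamma> (t$i - \<tau>) * f (upd t i \<tau>)))"
  define J where "J = (\<lambda>f. integral {t$i..b$i} (\<lambda>\<tau>. k \<gamma> (\<tau> - t$i) * f (upd t i \<tau>)))"
  have f: "((\<lambda>\<tau>. k \<gamma> (t$i - \<tau>) * f (upd t i \<tau>)) has_integral I f) {a$i..t$i}"
    "((\<lambda>\<tau>. k \<gamma> (\<tau> - t$i) * f (upd t i \<tau>)) has_integral J f) {t$i..b$i}"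
    and g: "((\<lambda>\<tau>. k \<gamma> (t$i - \<tau>) * g (upd t i \<tau>)) has_integral I g) {a$i..t$i}"
    "((\<lambda>\<tau>. k \<gamma> (\<tau> - t$i) * g (upd t i \<tau>)) has_integral J g) {t$i..b$i}"
    using ex unfolding Kop_exists_def I_def J_def by (auto intro: integrable_integral)
  have hh: "h (upd t i \<tau>) = f (upd t i \<tau>) + c * g (upd t i \<tau>)" if "\<tau> \<in> {a$i..b$i}" for \<tau>
    using h upd_mem_cbox[OF t that] by simp
  have 1: "((\<lambda>\<tau>. k \<gamma> (t$i - \<tau>) * h (upd t i \<tau>)) has_integral I f + c * I g) {a$i..t$i}"
    by (rule has_integral_eq[OF _ has_integral_add[OF f(1) has_integral_mult_right[OF g(1), of c]]])
      (use at in \<open>auto simp: hh algebra_simps\<close>)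
  have 2: "((\<lambda>\<tau>. k \<gamma> (\<tau> - t$i) * h (upd t i \<tau>)) has_integral J f + c * J g) {t$i..b$i}"
    by (rule has_integral_eq[OF _ has_integral_add[OF f(2) has_integral_mult_right[OF g(2), of c]]])
      (use at in \<open>auto simp: hh algebra_simps\<close>)
  show "Kop_exists k \<gamma> a b i h t"
    using 1 2 unfolding Kop_exists_def by blast
  show "Kop k \<gamma> a b p q i h t = Kop k \<gamma> a b p q i f t + c * Kop k \<gamma> a b p q i g t"
    using 1 2 f g unfolding Kop_def by (simp add: integral_unique algebra_simps)
qed

subsection \<open>Test functions and integration by parts\<close>

definition bump :: "'a::euclidean_space \<Rightarrow> real \<Rightarrow> 'a \<Rightarrow> real" where
  "bump t0 r t = (max 0 (r\<^sup>2 - (t - t0) \<bullet> (t - t0)))\<^sup>2"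

text \<open>The Frechet derivative of \<open>bump t0 r\<close> at \<open>t\<close> in direction
  \<open>x\<close>; the factor -4 combines 2 from the outer square with -2 from the inner
  product.\<close>

definition dbump :: "'a::euclidean_space \<Rightarrow> real \<Rightarrow> 'a \<Rightarrow> 'a \<Rightarrow> real" where
  "dbump t0 r t x = - 4 * max 0 (r\<^sup>2 - (t - t0) \<bullet> (t - t0)) * ((t - t0) \<bullet> x)"

text \<open>Squaring removes the corner of the positive part: at 0 the difference quotient is
  bounded by the absolute value of the increment. This is why a bump is of class C^1.\<close>

lemma DERIV_square_pos_part:
  "((\<lambda>z. (max 0 z)\<^sup>2) has_real_derivative 2 * max 0 z) (at z)" for z :: real
proof -
  consider "z > 0" | "z < 0" | "z = 0" by linarith
  then show ?thesis
  proof cases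
    case 1
    have "((\<lambda>z. z\<^sup>2) has_real_derivative 2 * max 0 z) (at z)"
      using 1 by (auto intro!: derivative_eq_intros)
    then show ?thesis
      by (rule has_field_derivative_transform_within_open[where S = "{0<..}"]) (use 1 in auto)
  next
    case 2
    have "((\<lambda>z. 0) has_real_derivative 2 * max 0 z) (at z)"
      using 2 by (auto intro!: derivative_eq_intros)
    then show ?thesis
      by (rule has_field_derivative_transform_within_open[where S = "{..<0}"]) (use 2 in auto)
  next
    case 3
    have "((\<lambda>h::real. (max 0 h)\<^sup>2 / h) \<longlongrightarrow> 0) (at 0)"
    proof (rule Lim_null_comparison)
      show "\<forall>\<^sub>F h in at 0. norm ((max 0 h)\<^sup>2 / h) \<le> \<bar>h\<bar>" for h :: real
        by (auto simp: max_def power2_eq_square)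
      show "((\<lambda>h::real. \<bar>h\<bar>) \<longlongrightarrow> 0) (at 0)"
        by (rule tendsto_eq_intros | simp)+
    qed
    then show ?thesis using 3 by (simp add: DERIV_def)
  qed
qed

lemma bump_has_derivative: "(bump t0 r has_derivative dbump t0 r t) (at t within S)"
proof -
  have "((\<lambda>t. r\<^sup>2 - (t - t0) \<bullet> (t - t0)) has_derivative (\<lambda>x. - 2 * ((t - t0) \<bullet> x))) (at t)"
    by (rule derivative_eq_intros refl | simp add: inner_commute)+
  from has_derivative_compose[OF this DERIV_square_pos_part[unfolded has_field_derivative_def]]
  have "(bump t0 r has_derivative dbump t0 r t) (at t)"
    unfolding bump_def dbump_def by (simp add: o_def mult_ac)
  then show ?thesis by (rule has_derivative_at_withinI)
qed

lemma continuous_on_bump: "continuous_on S (bump t0 r)"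
  unfolding bump_def by (intro continuous_intros)

lemma continuous_on_dbump: "continuous_on S (\<lambda>t. dbump t0 r t x)"
  unfolding dbump_def by (intro continuous_intros)

lemma pos_part_outside:
  assumes "t \<notin> cball t0 r" "r > 0"
  shows "max 0 (r\<^sup>2 - (t - t0) \<bullet> (t - t0)) = 0"
proof -
  have "r < norm (t - t0)" using assms by (simp add: dist_norm norm_minus_commute)
  then have "r\<^sup>2 < (norm (t - t0))\<^sup>2" using assms(2) by (intro power_strict_mono) auto
  then show ?thesis by (simp add: power2_norm_eq_inner)
qed

lemma bump_outside: "t \<notin> cball t0 r \<Longrightarrow> r > 0 \<Longrightarrow> bump t0 r t = 0"
  and dbump_outside: "t \<notin> cball t0 r \<Longrightarrow> r > 0 \<Longrightarrow> dbump t0 r t x = 0"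
  using pos_part_outside unfolding bump_def dbump_def by fastforce+

lemma bump_nonneg: "0 \<le> bump t0 r t"
  by (simp add: bump_def)

lemma bump_center: "r > 0 \<Longrightarrow> bump t0 r t0 > 0"
  by (simp add: bump_def)

text \<open>If \<open>E t0\<close> were nonzero, \<open>E t0 * E t\<close> would be positive on a
  small ball; the factor \<open>E t0\<close> treats both signs at once. Against a bump supported in
  that ball the integrand is continuous and nonnegative with integral 0, so it vanishes at
  \<open>t0\<close>, where the bump is positive.\<close>

lemma fundamental_lemma:
  fixes E :: "'a::euclidean_space \<Rightarrow> real"
  assumes E: "continuous_on (cbox a b) E" and t0: "t0 \<in> box a b"
    and zero: "\<And>r. r > 0 \<Longrightarrow> cball t0 r \<subseteq> box a b \<Longrightarrow> integral (cbox a b) (\<lambda>t. E t * bump t0 r t) = 0"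
  shows "E t0 = 0"
proof (rule ccontr)
  assume ne: "E t0 \<noteq> 0"
  have "continuous_on (box a b) (\<lambda>t. E t0 * E t)"
    using continuous_on_subset[OF E box_subset_cbox] by (intro continuous_intros)
  then have "open (box a b \<inter> (\<lambda>t. E t0 * E t) -` {0<..})"
    by (rule continuous_open_preimage) auto
  moreover have "t0 \<in> box a b \<inter> (\<lambda>t. E t0 * E t) -` {0<..}"
    using t0 ne by (auto simp: zero_less_mult_iff)
  ultimately obtain r where r: "r > 0" "cball t0 r \<subseteq> box a b \<inter> (\<lambda>t. E t0 * E t) -` {0<..}"
    using open_contains_cball by metis
  have rb: "cball t0 r \<subseteq> box a b" using r(2) by blast
  let ?f = "\<lambda>t. E t0 * (E t * bump t0 r t)"
  have cont: "continuous_on (cbox a b) (\<lambda>t. E t * bump t0 r t)"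
    by (intro continuous_intros E continuous_on_bump)
  have "((\<lambda>t. E t * bump t0 r t) has_integral 0) (cbox a b)"
    using zero[OF r(1) rb] integrable_integral[OF integrable_continuous[OF cont]] by simp
  from has_integral_mult_right[OF this, of "E t0"]
  have int: "(?f has_integral 0) (cbox a b)" by simp
  have "?f t \<ge> 0" for t
  proof (cases "t \<in> cball t0 r")
    case True
    then have "E t0 * E t \<ge> 0" using r(2) by auto
    then show ?thesis using bump_nonneg[of t0 r t] by (metis mult.assoc mult_nonneg_nonneg)
  next
    case False then show ?thesis by (simp add: bump_outside r(1))
  qed
  then have "?f t0 = 0"
    by (intro has_integral_0_cbox_imp_0[OF _ _ int])
      (use t0 box_subset_cbox cont in \<open>auto intro!: continuous_on_mult_left\<close>)
  then show False using ne bump_center[OF r(1), of t0] by auto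
qed

text \<open>Differentiating the constant function \<open>s \<mapsto> \<integral> H (t + s e) dt\<close> at \<open>0\<close> replaces the
  iterated integration of the divergence theorem.\<close>

lemma integral_directional_derivative_eq_0:
  fixes H :: "'a::euclidean_space \<Rightarrow> real"
  assumes H: "continuous_on UNIV H" and DH: "continuous_on UNIV DH"
    and der: "\<And>t. ((\<lambda>s. H (t + s *\<^sub>R e)) has_real_derivative DH t) (at 0)"
    and H0: "\<And>t. t \<notin> cbox a b \<Longrightarrow> H t = 0" and DH0: "\<And>t. t \<notin> cbox a b \<Longrightarrow> DH t = 0"
  shows "integral (cbox a b) DH = 0"
proof -
  \<comment> \<open>A padding: a shift by \<open>s *\<^sub>R e\<close> with \<open>s\<close> in
    \<open>?U\<close> changes each coordinate by at most \<open>norm e\<close>, so the enlarged box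
    \<open>?B\<close> contains the supports of all these translates.\<close>
  define w where "w = (\<Sum>i\<in>Basis. norm e *\<^sub>R i :: 'a)"
  have w: "w \<bullet> i = norm e" if "i \<in> Basis" for i
    using that by (simp add: w_def inner_sum_left inner_Basis if_distrib cong: if_cong)
  let ?U = "{-1<..<1::real}"
  let ?B = "cbox (a - w) (b + w)"
  have outside: "t + s *\<^sub>R e \<notin> cbox a b" if "t \<notin> ?B" "s \<in> ?U" for t s
  proof
    assume *: "t + s *\<^sub>R e \<in> cbox a b"
    have "t \<in> ?B"
      unfolding mem_box
    proof
      fix i :: 'a assume i: "i \<in> Basis"
      have "\<bar>s * (e \<bullet> i)\<bar> \<le> 1 * norm e"
        unfolding abs_mult using that(2) Basis_le_norm[OF i, of e] by (intro mult_mono) auto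
      moreover have "a \<bullet> i \<le> t \<bullet> i + s * (e \<bullet> i)" "t \<bullet> i + s * (e \<bullet> i) \<le> b \<bullet> i"
        using * i by (auto simp: mem_box inner_add_left)
      ultimately show "(a - w) \<bullet> i \<le> t \<bullet> i \<and> t \<bullet> i \<le> (b + w) \<bullet> i"
        using w[OF i] by (auto simp: inner_add_left inner_diff_left)
    qed
    with that(1) show False by simp
  qed
  have sub: "cbox a b \<subseteq> ?B"
    using outside[of _ 0] by fastforce
  have "((\<lambda>s. integral ?B (\<lambda>t. H (t + s *\<^sub>R e))) has_field_derivative
      integral ?B (\<lambda>t. DH (t + 0 *\<^sub>R e))) (at 0 within ?U)"
  proof (rule leibniz_rule_field_derivative)
    show "((\<lambda>s. H (t + s *\<^sub>R e)) has_field_derivative DH (t + s *\<^sub>R e)) (at s within ?U)" for s t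
    proof -
      \<comment> \<open>The hypothesis gives the derivative at parameter 0; it is applied at the
        point \<open>t + s *\<^sub>R e\<close> and recentred at \<open>s\<close>.\<close>
      have "((\<lambda>h. H (t + s *\<^sub>R e + h *\<^sub>R e)) has_real_derivative DH (t + s *\<^sub>R e)) (at (s - s))"
        using der by simp
      from DERIV_chain2[where g = "\<lambda>x. x - s" and x = s and Db = 1 and s = UNIV, OF this]
      have "((\<lambda>x. H (t + s *\<^sub>R e + (x - s) *\<^sub>R e)) has_real_derivative DH (t + s *\<^sub>R e)) (at s)"
        by (simp add: DERIV_diff[OF DERIV_ident DERIV_const, simplified])
      then show ?thesis
        by (simp add: algebra_simps has_field_derivative_at_within)
    qed
    show "(\<lambda>t. H (t + s *\<^sub>R e)) integrable_on ?B" for s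
      by (intro integrable_continuous continuous_on_compose2[OF H] continuous_intros) auto
    show "continuous_on (?U \<times> ?B) (\<lambda>(s, t). DH (t + s *\<^sub>R e))"
      unfolding split_beta by (intro continuous_on_compose2[OF DH] continuous_intros) auto
  qed auto
  then have d1: "((\<lambda>s. integral ?B (\<lambda>t. H (t + s *\<^sub>R e))) has_real_derivative integral ?B DH) (at 0)"
    by (simp add: at_within_open[of 0 ?U])
  \<comment> \<open>Translation invariance makes the parameter integral constant in
    \<open>s\<close>, so its derivative, just computed under the integral sign, is 0.\<close>
  have const: "integral ?B (\<lambda>t. H (t + s *\<^sub>R e)) = (\<integral>t. H t \<partial>lborel)" if "s \<in> ?U" for s
  proof -
    have "integral ?B (\<lambda>t. H (t + s *\<^sub>R e)) = (\<integral>t. H (t + s *\<^sub>R e) \<partial>lborel)"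
      by (intro integral_cbox_eq_lborel continuous_on_compose2[OF H] continuous_intros)
        (use H0 outside that in auto)
    also have "\<dots> = (\<integral>t. H t \<partial>lborel)"
      using lborel_integral_translate[of H "s *\<^sub>R e"] H
      by (simp add: add.commute borel_measurable_continuous_onI)
    finally show ?thesis .
  qed
  have "((\<lambda>s. integral ?B (\<lambda>t. H (t + s *\<^sub>R e))) has_real_derivative 0) (at 0)"
    by (rule has_field_derivative_transform_within_open[where S = ?U and f = "\<lambda>s. (\<integral>t. H t \<partial>lborel)"])
      (use const in auto)
  with d1 have "integral ?B DH = 0" using DERIV_unique by blast
  moreover have "integral ?B DH = (\<integral>t. DH t \<partial>lborel)"
    by (rule integral_cbox_eq_lborel) (use DH sub DH0 in \<open>auto intro: continuous_on_subset\<close>)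
  moreover have "integral (cbox a b) DH = (\<integral>t. DH t \<partial>lborel)"
    by (rule integral_cbox_eq_lborel) (use DH DH0 in \<open>auto intro: continuous_on_subset\<close>)
  ultimately show ?thesis by simp
qed

text \<open>The product of \<open>G\<close> with the bump has support in the open box, so it extends
  by zero to a function with continuous derivative along \<open>e\<close>. The integral of that
  derivative is 0, and the product rule splits it into the two sides.\<close>

lemma integral_by_parts_bump:
  fixes G :: "'a::euclidean_space \<Rightarrow> real"
  assumes G: "\<And>t. t \<in> cbox a b \<Longrightarrow> (G has_derivative blinfun_apply (G' t)) (at t within cbox a b)"
    and G': "continuous_on (cbox a b) G'"
    and r: "r > 0" "cball t0 r \<subseteq> box a b"
  shows "integral (cbox a b) (\<lambda>t. G t * dbump t0 r t e) = - integral (cbox a b) (\<lambda>t. G' t e * bump t0 r t)"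
proof -
  have cG: "continuous_on (cbox a b) G"
    using G by (meson has_derivative_continuous_on)
  have cG'e: "continuous_on (cbox a b) (\<lambda>t. G' t e)"
    by (intro continuous_intros G')
  define H where "H = zero_ext (box a b) (\<lambda>t. G t * bump t0 r t)"
  define D where "D = zero_ext (box a b) (\<lambda>t. G t * dbump t0 r t e + G' t e * bump t0 r t)"
  \<comment> \<open>Two open sets cover the space: on the box \<open>H\<close> and \<open>D\<close>
    are given by their formulas, and off the ball they vanish. Continuity and differentiability are
    checked on each separately.\<close>
  have Un: "box a b \<union> - cball t0 r = UNIV" using r by auto
  have op: "open (- cball t0 r)" by (simp add: open_Compl)
  have H0: "H t = 0" and D0: "D t = 0" if "t \<notin> cball t0 r" for t
    using that r(1) by (auto simp: H_def D_def zero_ext_def bump_outside dbump_outside)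
  have cH: "continuous_on UNIV H"
    unfolding Un[symmetric]
  proof (rule continuous_on_open_Un)
    show "continuous_on (box a b) H"
      by (rule continuous_on_eq[of _ "\<lambda>t. G t * bump t0 r t"])
        (auto simp: H_def intro!: continuous_intros continuous_on_bump continuous_on_subset[OF cG box_subset_cbox])
    show "continuous_on (- cball t0 r) H"
      by (rule continuous_on_eq[of _ "\<lambda>t. 0"]) (use H0 in auto)
  qed (auto simp: op)
  have cD: "continuous_on UNIV D"
    unfolding Un[symmetric]
  proof (rule continuous_on_open_Un)
    show "continuous_on (box a b) D"
      by (rule continuous_on_eq[of _ "\<lambda>t. G t * dbump t0 r t e + G' t e * bump t0 r t"])
        (auto simp: D_def intro!: continuous_on_add continuous_on_mult continuous_on_bump continuous_on_dbump
          continuous_on_subset[OF cG box_subset_cbox] continuous_on_subset[OF cG'e box_subset_cbox])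
    show "continuous_on (- cball t0 r) D"
      by (rule continuous_on_eq[of _ "\<lambda>t. 0"]) (use D0 in auto)
  qed (auto simp: op)
  have der: "((\<lambda>s. H (t + s *\<^sub>R e)) has_real_derivative D t) (at 0)" for t
  proof -
    have "\<exists>H'. (H has_derivative H') (at t) \<and> H' e = D t"
    proof (cases "t \<in> box a b")
      case True
      have "at t within cbox a b = at t"
        by (rule at_within_interior) (use True in \<open>simp add: interior_cbox\<close>)
      then have Gt: "(G has_derivative blinfun_apply (G' t)) (at t)"
        using G[of t] True box_subset_cbox by (metis subsetD)
      have "((\<lambda>t. G t * bump t0 r t) has_derivative (\<lambda>x. G t * dbump t0 r t x + G' t x * bump t0 r t)) (at t)"
        by (rule has_derivative_mult[OF Gt bump_has_derivative])
      then have "(H has_derivative (\<lambda>x. G t * dbump t0 r t x + G' t x * bump t0 r t)) (at t)"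
        by (rule has_derivative_transform_within_open[OF _ open_box True]) (simp add: H_def)
      then show ?thesis using True by (auto simp: D_def)
    next
      case False
      then have t: "t \<in> - cball t0 r" using r by auto
      have "((\<lambda>t. 0) has_derivative (\<lambda>x. 0 :: real)) (at t)" by simp
      then have "(H has_derivative (\<lambda>x. 0)) (at t)"
        by (rule has_derivative_transform_within_open[OF _ op t]) (use H0 in auto)
      then show ?thesis using D0 t by auto
    qed
    then obtain H' where H': "(H has_derivative H') (at t)" "H' e = D t" by blast
    have "((\<lambda>s. t + s *\<^sub>R e) has_derivative (\<lambda>h. h *\<^sub>R e)) (at 0)"
      by (auto intro!: derivative_eq_intros)
    from has_derivative_compose[OF this, of H H'] H'(1)
    have "((\<lambda>s. H (t + s *\<^sub>R e)) has_derivative (\<lambda>h. H' (h *\<^sub>R e))) (at 0)" by simp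
    moreover have "(\<lambda>h. H' (h *\<^sub>R e)) = (*) (D t)"
      using H' has_derivative_linear[OF H'(1)] by (auto simp: linear_cmul mult.commute)
    ultimately show ?thesis by (simp add: has_field_derivative_def)
  qed
  \<comment> \<open>On the faces of the box \<open>D\<close> is 0 by definition; the formula agrees
    there because the bump and its derivative vanish off the ball.\<close>
  have eq: "D t = G t * dbump t0 r t e + G' t e * bump t0 r t" if "t \<in> cbox a b" for t
  proof (cases "t \<in> box a b")
    case False
    then have "t \<notin> cball t0 r" using r by auto
    then show ?thesis using r(1) by (simp add: D0 bump_outside dbump_outside)
  qed (simp add: D_def)
  have "cball t0 r \<subseteq> cbox a b" using r(2) box_subset_cbox by blast
  then have "integral (cbox a b) D = 0"
    by (intro integral_directional_derivative_eq_0[OF cH cD der]) (blast intro: H0 D0)+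
  also have "integral (cbox a b) D =
      integral (cbox a b) (\<lambda>t. G t * dbump t0 r t e + G' t e * bump t0 r t)"
    by (rule integral_cong) (rule eq)
  also have "\<dots> = integral (cbox a b) (\<lambda>t. G t * dbump t0 r t e) + integral (cbox a b) (\<lambda>t. G' t e * bump t0 r t)"
    by (rule integral_add)
      (intro integrable_continuous continuous_on_mult cG cG'e continuous_on_bump continuous_on_dbump)+
  finally show ?thesis by simp
qed

subsection \<open>The first variation\<close>

lemma upd_self [simp]: "upd t i (t$i) = t"
  by (simp add: upd_eq)

text \<open>The chain rule along a coordinate segment. On the faces of the box the derivative is
  one-sided, and \<open>a$i < b$i\<close> makes it unique.\<close>

lemma pd_eq:
  fixes t :: "real^'n"
  assumes g: "(g has_derivative g') (at t within cbox a b)" and t: "t \<in> cbox a b" and ab: "a$i < b$i"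
  shows "pd a b i g t = g' (axis i 1)"
proof -
  have "(upd t i has_vector_derivative axis i 1) (at (t$i) within {a$i..b$i})"
    unfolding upd_eq by (auto intro!: derivative_eq_intros)
  moreover have "(g has_derivative g') (at (upd t i (t$i)) within upd t i ` {a$i..b$i})"
    unfolding upd_self by (rule has_derivative_subset[OF g]) (use upd_mem_cbox[OF t] in auto)
  ultimately have "((g \<circ> upd t i) has_vector_derivative g' (axis i 1)) (at (t$i) within {a$i..b$i})"
    using vector_derivative_diff_chain_within by blast
  moreover have "t$i \<in> {a$i..b$i}" using t by (auto simp: mem_box_cart)
  ultimately show ?thesis
    unfolding pd_def using vector_derivative_within_closed_interval[OF ab] by (auto simp: o_def)
qed

lemma has_derivative_vec_nth:
  assumes "(u has_derivative u') F"
  shows "((\<lambda>s. u s $ j) has_derivative (\<lambda>x. u' x $ j)) F"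
  using bounded_linear.has_derivative[OF bounded_linear_vec_nth assms] .

text \<open>The point may lie on the boundary of \<open>S\<close>: as the whole line stays in
  \<open>S\<close>, the derivative within \<open>S\<close> restricts to a two-sided derivative in
  the line parameter.\<close>

lemma DERIV_along_line:
  fixes \<Phi> :: "'a::real_normed_vector \<Rightarrow> real"
  assumes "(\<Phi> has_derivative \<Phi>') (at (z + c *\<^sub>R d) within S)" "\<And>s. z + s *\<^sub>R d \<in> S"
  shows "((\<lambda>s. \<Phi> (z + s *\<^sub>R d)) has_real_derivative \<Phi>' d) (at c)"
proof -
  have "((\<lambda>s. z + s *\<^sub>R d) has_vector_derivative d) (at c within UNIV)"
    by (auto intro!: derivative_eq_intros)
  moreover have "(\<Phi> has_derivative \<Phi>') (at (z + c *\<^sub>R d) within range (\<lambda>s. z + s *\<^sub>R d))"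
    by (rule has_derivative_subset[OF assms(1)]) (use assms(2) in auto)
  ultimately have "((\<Phi> \<circ> (\<lambda>s. z + s *\<^sub>R d)) has_vector_derivative \<Phi>' d) (at c within UNIV)"
    using vector_derivative_diff_chain_within by blast
  then show ?thesis
    by (simp add: o_def has_real_derivative_iff_has_vector_derivative)
qed

text \<open>The directions of the \<open>x\<close>, \<open>v\<close> and \<open>w\<close> variables
  have zero \<open>t\<close> component, so lines along them remain in \<open>T \<times> UNIV\<close>
  even when \<open>t\<close> is a boundary point of \<open>T\<close>.\<close>

lemma partials_eq_derivative:
  fixes F :: "real^'n \<Rightarrow> real^'m \<Rightarrow> real^'n^'m \<Rightarrow> real^'n^'m \<Rightarrow> real"
  assumes \<Phi>: "((\<lambda>(t, x, v, w). F t x v w) has_derivative \<Phi>') (at (t, x, v, w) within T \<times> UNIV)"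
    and t: "t \<in> T"
  shows "dxF F kk t x v w = \<Phi>' (0, axis kk 1, 0, 0)"
    and "dvF F kk i t x v w = \<Phi>' (0, 0, axis kk (axis i 1), 0)"
    and "dwF F kk i t x v w = \<Phi>' (0, 0, 0, axis kk (axis i 1))"
proof -
  have upd2: "upd2 v kk i s = v + (s - v$kk$i) *\<^sub>R axis kk (axis i 1)" for v :: "real^'n^'m" and s
    by (auto simp: upd2_def vec_eq_iff axis_def)
  let ?\<Phi> = "\<lambda>(t, x, v, w). F t x v w"
  have line: "((\<lambda>s. ?\<Phi> ((t, x, v, w) + (s - c) *\<^sub>R d)) has_real_derivative \<Phi>' d) (at c)"
    if "fst d = 0" for d c
  proof -
    have "((\<lambda>s. ?\<Phi> (((t, x, v, w) - c *\<^sub>R d) + s *\<^sub>R d)) has_real_derivative \<Phi>' d) (at c)"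
      by (rule DERIV_along_line[where S = "T \<times> UNIV"]) (use \<Phi> t that in \<open>auto simp: mem_Times_iff\<close>)
    then show ?thesis by (simp add: algebra_simps)
  qed
  show "dxF F kk t x v w = \<Phi>' (0, axis kk 1, 0, 0)"
    unfolding dxF_def by (rule DERIV_imp_deriv)
      (use line[of "(0, axis kk 1, 0, 0)" "x$kk"] in \<open>simp add: upd_eq\<close>)
  show "dvF F kk i t x v w = \<Phi>' (0, 0, axis kk (axis i 1), 0)"
    unfolding dvF_def by (rule DERIV_imp_deriv)
      (use line[of "(0, 0, axis kk (axis i 1), 0)" "v$kk$i"] in \<open>simp add: upd2\<close>)
  show "dwF F kk i t x v w = \<Phi>' (0, 0, 0, axis kk (axis i 1))"
    unfolding dwF_def by (rule DERIV_imp_deriv)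
      (use line[of "(0, 0, 0, axis kk (axis i 1))" "w$kk$i"] in \<open>simp add: upd2\<close>)
qed

text \<open>Here \<open>axis kk x\<close> is the array with row \<open>kk\<close> equal to
  \<open>x\<close> and all other rows zero, expanded in the unit arrays.\<close>

lemma axis_row_sum: "axis kk x = (\<Sum>i\<in>UNIV. x$i *\<^sub>R axis kk (axis i 1))" for x :: "real^'n"
proof -
  have "(\<Sum>i\<in>UNIV. x$i * (if j = i then 1 else 0)) = x$j" for j
    by (simp add: if_distrib cong: if_cong)
  then show ?thesis
    by (auto simp: vec_eq_iff axis_def sum_component if_distrib eq_commute cong: if_cong)
qed

text \<open>Linearity resolves a variation confined to component \<open>kk\<close> into the
  directions that define the partial derivatives of the Lagrangian.\<close>

lemma blinfun_apply_row:
  fixes L :: "('t::real_normed_vector \<times> (real^'m) \<times> (real^'n^'m) \<times> (real^'n^'m)) \<Rightarrow>\<^sub>L real"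
  shows "L (0, axis kk h, axis kk x, axis kk y) =
     h * L (0, axis kk 1, 0, 0)
   + (\<Sum>i\<in>UNIV. x$i * L (0, 0, axis kk (axis i 1), 0))
   + (\<Sum>i\<in>UNIV. y$i * L (0, 0, 0, axis kk (axis i 1)))"
proof -
  have h: "axis kk h = h *\<^sub>R (axis kk 1 :: real^'m)"
    by (auto simp: vec_eq_iff axis_def)
  have "(0 :: 't, axis kk h, axis kk x, axis kk y) =
     h *\<^sub>R (0, axis kk 1, 0, 0)
   + (\<Sum>i\<in>UNIV. x$i *\<^sub>R (0, 0, axis kk (axis i 1), 0))
   + (\<Sum>i\<in>UNIV. y$i *\<^sub>R (0, 0, 0, axis kk (axis i 1)))"
    by (simp add: prod_eq_iff fst_sum snd_sum axis_row_sum[of kk x] axis_row_sum[of kk y] h[symmetric])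
  then show ?thesis
    by (simp only: blinfun.add_right blinfun.sum_right blinfun.scaleR_right real_scaleR_def)
qed

section \<open>Perturbation of one component by a bump\<close>

lemma continuous_on_gradB_gradK:
  fixes u :: "real^'n \<Rightarrow> real^'m"
  assumes "admissible k \<alpha> \<beta> a b p1 q1 p2 q2 \<psi> u"
  shows "continuous_on (cbox a b) u"
    "continuous_on (cbox a b) (gradB k \<alpha> a b p1 q1 u)"
    "continuous_on (cbox a b) (gradK k \<beta> a b p2 q2 u)"
  using assms unfolding admissible_def C1_on_def
  by (auto intro: has_derivative_continuous_on
      simp: gradB_def[abs_def] gradK_def[abs_def] intro!: continuous_on_vec_lambda)

text \<open>Both gradients are linear in \<open>u\<close>, so perturbing component \<open>kk\<close>
  adds \<open>\<epsilon>\<close> times an array supported in row \<open>kk\<close>. The perturbed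
  function stays admissible because the bump is C^1, vanishes on the boundary of the box, and has
  continuous images under the operators.\<close>

lemma variation_grad:
  fixes u :: "real^'n \<Rightarrow> real^'m" and kk :: 'm
  assumes ab: "\<forall>i. a$i < b$i"
    and kL1: "\<forall>i. k (1 - \<alpha>$i) absolutely_integrable_on {0<..<b$i - a$i}
              \<and> k (\<beta>$i) absolutely_integrable_on {0<..<b$i - a$i}"
    and adm: "admissible k \<alpha> \<beta> a b p1 q1 p2 q2 \<psi> u"
    and r: "r > 0" "cball t0 r \<subseteq> box a b"
  defines "BH \<equiv> \<lambda>t. \<chi> i. Kop k (1 - \<alpha>$i) a b (p1$i) (q1$i) i (\<lambda>t. dbump t0 r t (axis i 1)) t"
    and "KH \<equiv> \<lambda>t. \<chi> i. Kop k (\<beta>$i) a b (p2$i) (q2$i) i (bump t0 r) t"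
    and "y \<equiv> \<lambda>\<epsilon> t. u t + \<epsilon> *\<^sub>R axis kk (bump t0 r t)"
  shows "continuous_on (cbox a b) BH" "continuous_on (cbox a b) KH"
    and "admissible k \<alpha> \<beta> a b p1 q1 p2 q2 \<psi> (y \<epsilon>)"
    and "t \<in> cbox a b \<Longrightarrow> gradB k \<alpha> a b p1 q1 (y \<epsilon>) t = gradB k \<alpha> a b p1 q1 u t + \<epsilon> *\<^sub>R axis kk (BH t)"
    and "t \<in> cbox a b \<Longrightarrow> gradK k \<beta> a b p2 q2 (y \<epsilon>) t = gradK k \<beta> a b p2 q2 u t + \<epsilon> *\<^sub>R axis kk (KH t)"
proof -
  let ?\<eta> = "bump t0 r"
  let ?d = "\<lambda>i t. dbump t0 r t (axis i 1)"
  have out: "t \<notin> cball t0 r" if "t \<notin> box a b" for t using r that by auto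
  have outc: "t \<notin> cball t0 r" if "t \<notin> cbox a b" for t using out box_subset_cbox that by blast
  have cB: "continuous_on (cbox a b) (Kop k (1 - \<alpha>$i) a b p q i (?d i))" for p q i
    by (rule continuous_on_Kop) (use kL1 r outc in \<open>auto simp: continuous_on_dbump dbump_outside\<close>)
  have cK: "continuous_on (cbox a b) (Kop k (\<beta>$i) a b p q i ?\<eta>)" for p q i
    by (rule continuous_on_Kop) (use kL1 r outc in \<open>auto simp: continuous_on_bump bump_outside\<close>)
  show cBH: "continuous_on (cbox a b) BH" and cKH: "continuous_on (cbox a b) KH"
    unfolding BH_def KH_def by (intro continuous_on_vec_lambda cB cK)+
  \<comment> \<open>The coefficient \<open>c j\<close> switches the perturbation on in component
    \<open>kk\<close> and off elsewhere, so all components share one formula.\<close>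
  define c where "c = (\<lambda>j. if j = kk then \<epsilon> else 0)"
  have yj: "y \<epsilon> s $ j = u s $ j + c j * ?\<eta> s" for s j
    by (auto simp: y_def c_def axis_def)
  obtain u' where u': "\<And>t. t \<in> cbox a b \<Longrightarrow> (u has_derivative blinfun_apply (u' t)) (at t within cbox a b)"
      "continuous_on (cbox a b) u'"
    using adm unfolding admissible_def C1_on_def by blast
  have pdu: "pd a b i (\<lambda>s. y \<epsilon> s $ j) t = pd a b i (\<lambda>s. u s $ j) t + c j * ?d i t"
    if t: "t \<in> cbox a b" for i j t
  proof -
    have uj: "((\<lambda>s. u s $ j) has_derivative (\<lambda>x. u' t x $ j)) (at t within cbox a b)"
      by (rule has_derivative_vec_nth[OF u'(1)[OF t]])
    have "((\<lambda>s. y \<epsilon> s $ j) has_derivative (\<lambda>x. u' t x $ j + c j * dbump t0 r t x)) (at t within cbox a b)"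
      unfolding yj by (intro has_derivative_add uj has_derivative_mult_right bump_has_derivative)
    then show ?thesis
      using pd_eq[OF _ t, of "\<lambda>s. y \<epsilon> s $ j"] pd_eq[OF uj t] ab by simp
  qed
  have exB: "Kop_exists k (1 - \<alpha>$i) a b i (pd a b i (\<lambda>s. u s $ j)) t"
    and exK: "Kop_exists k (\<beta>$i) a b i (\<lambda>s. u s $ j) t" if "t \<in> cbox a b" for i j t
    using adm that unfolding admissible_def by auto
  have ed: "Kop_exists k (1 - \<alpha>$i) a b i (?d i) t" "Kop_exists k (\<beta>$i) a b i ?\<eta> t" if "t \<in> cbox a b" for i t
    using kL1 that by (auto intro!: Kop_exists_continuous continuous_on_dbump continuous_on_bump)
  note B = Kop_add_scaled[OF _ exB ed(1) pdu] and K = Kop_add_scaled[OF _ exK ed(2) yj]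
  have Beq: "Bop k (\<alpha>$i) a b (p1$i) (q1$i) i (\<lambda>s. y \<epsilon> s $ j) t =
      Bop k (\<alpha>$i) a b (p1$i) (q1$i) i (\<lambda>s. u s $ j) t + c j * BH t $ i" if "t \<in> cbox a b" for t i j
    unfolding Bop_def BH_def using B(2)[OF that that that] by simp
  have Keq: "Kop k (\<beta>$i) a b (p2$i) (q2$i) i (\<lambda>s. y \<epsilon> s $ j) t =
      Kop k (\<beta>$i) a b (p2$i) (q2$i) i (\<lambda>s. u s $ j) t + c j * KH t $ i" if "t \<in> cbox a b" for t i j
    unfolding KH_def using K(2)[OF that that that] by simp
  show "gradB k \<alpha> a b p1 q1 (y \<epsilon>) t = gradB k \<alpha> a b p1 q1 u t + \<epsilon> *\<^sub>R axis kk (BH t)" if "t \<in> cbox a b"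
    using that by (auto simp: gradB_def vec_eq_iff Beq c_def axis_def)
  show "gradK k \<beta> a b p2 q2 (y \<epsilon>) t = gradK k \<beta> a b p2 q2 u t + \<epsilon> *\<^sub>R axis kk (KH t)" if "t \<in> cbox a b"
    using that by (auto simp: gradK_def vec_eq_iff Keq c_def axis_def)
  show "admissible k \<alpha> \<beta> a b p1 q1 p2 q2 \<psi> (y \<epsilon>)"
    unfolding admissible_def
  proof (intro conjI allI ballI)
    show "C1_on (cbox a b) (y \<epsilon>)"
    proof -
      \<comment> \<open>The derivative of the vector-valued bump, built from bounded linear maps so
        that its continuity in operator norm follows from composition.\<close>
      define E where "E = (\<lambda>t. (- 4 * max 0 (r\<^sup>2 - (t - t0) \<bullet> (t - t0))) *\<^sub>R
        (blinfun_scaleR_left (axis kk 1 :: real^'m) o\<^sub>L blinfun_inner_left (t - t0)))"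
      have E: "blinfun_apply (E t) = (\<lambda>x. axis kk (dbump t0 r t x))" for t
        by (auto simp: fun_eq_iff E_def dbump_def vec_eq_iff axis_def blinfun.scaleR_left blinfun.minus_left inner_commute)
      have "(y \<epsilon> has_derivative blinfun_apply (u' t + \<epsilon> *\<^sub>R E t)) (at t within cbox a b)"
        if "t \<in> cbox a b" for t
      proof -
        have "((\<lambda>s. axis kk (?\<eta> s) :: real^'m) has_derivative (\<lambda>x. axis kk (dbump t0 r t x)))
            (at t within cbox a b)"
          by (rule bounded_linear.has_derivative[OF _ bump_has_derivative])
            (auto simp: linear_conv_bounded_linear[symmetric] linear_iff vec_eq_iff axis_def)
        then show ?thesis
          unfolding y_def blinfun.add_left blinfun.scaleR_left E
          by (intro has_derivative_add u'(1) that has_derivative_scaleR_right)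
      qed
      moreover have "continuous_on (cbox a b) (\<lambda>t. u' t + \<epsilon> *\<^sub>R E t)"
        unfolding E_def
        by (intro continuous_on_add u'(2) continuous_on_scaleR continuous_on_const
            bounded_bilinear.continuous_on[OF bounded_bilinear_blinfun_compose]
            bounded_linear.continuous_on[OF bounded_linear_blinfun_inner_left])
          (intro continuous_intros)+
      ultimately show ?thesis
        unfolding C1_on_def by (intro exI[of _ "\<lambda>t. u' t + \<epsilon> *\<^sub>R E t"]) simp
    qed
    fix j i
    show "Kop_exists k (1 - \<alpha>$i) a b i (pd a b i (\<lambda>s. y \<epsilon> s $ j)) t" if "t \<in> cbox a b" for t
      using B(1) that by blast
    show "Kop_exists k (\<beta>$i) a b i (\<lambda>s. y \<epsilon> s $ j) t" if "t \<in> cbox a b" for t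
      using K(1) that by blast
    have "continuous_on (cbox a b) (\<lambda>t. Bop k (\<alpha>$i) a b (p1$i) (q1$i) i (\<lambda>s. u s $ j) t + c j * BH t $ i)"
      using adm unfolding admissible_def by (auto intro!: continuous_intros cBH)
    then show "continuous_on (cbox a b) (Bop k (\<alpha>$i) a b (p1$i) (q1$i) i (\<lambda>s. y \<epsilon> s $ j))"
      by (rule continuous_on_eq) (simp add: Beq)
    have "continuous_on (cbox a b) (\<lambda>t. Kop k (\<beta>$i) a b (p2$i) (q2$i) i (\<lambda>s. u s $ j) t + c j * KH t $ i)"
      using adm unfolding admissible_def by (auto intro!: continuous_intros cKH)
    then show "continuous_on (cbox a b) (Kop k (\<beta>$i) a b (p2$i) (q2$i) i (\<lambda>s. y \<epsilon> s $ j))"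
      by (rule continuous_on_eq) (simp add: Keq)
  next
    fix t assume "t \<in> frontier (cbox a b)"
    then have "t \<notin> box a b" by (simp add: frontier_cbox)
    then have "?\<eta> t = 0" using out r(1) by (simp add: bump_outside)
    moreover have "u t = \<psi> t" using adm \<open>t \<in> frontier _\<close> unfolding admissible_def by blast
    ultimately show "y \<epsilon> t = \<psi> t" by (simp add: y_def vec_eq_iff axis_def)
  qed
qed

lemma continuous_on_axis:
  fixes f :: "'a::topological_space \<Rightarrow> 'b::real_normed_vector"
  assumes "continuous_on S f"
  shows "continuous_on S (\<lambda>t. axis j (f t) :: 'b^'m)"
  unfolding axis_def
proof (rule continuous_on_vec_lambda)
  show "continuous_on S (\<lambda>t. if i = j then f t else 0)" for i
    using assms by (cases "i = j") auto
qed

text \<open>Along the perturbations the functional is a real function of \<open>\<epsilon>\<close>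
  with an extremum at 0. Its derivative there, taken under the integral sign, is the integral of the
  derivative of the Lagrangian in the direction of the variation.\<close>

lemma first_variation_eq_0:
  fixes F :: "real^'n \<Rightarrow> real^'m \<Rightarrow> real^'n^'m \<Rightarrow> real^'n^'m \<Rightarrow> real"
    and k :: "real \<Rightarrow> real \<Rightarrow> real"
    and \<alpha> \<beta> a b p1 q1 p2 q2 t0 :: "real^'n" and r :: real and kk :: 'm
    and \<psi> u :: "real^'n \<Rightarrow> real^'m"
  defines "\<Phi> \<equiv> \<lambda>(t, x, v, w). F t x v w"
    and "z \<equiv> \<lambda>t. (t, u t, gradB k \<alpha> a b p1 q1 u t, gradK k \<beta> a b p2 q2 u t)"
    and "BH \<equiv> \<lambda>t. \<chi> i. Kop k (1 - \<alpha>$i) a b (p1$i) (q1$i) i (\<lambda>t. dbump t0 r t (axis i 1)) t"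
    and "KH \<equiv> \<lambda>t. \<chi> i. Kop k (\<beta>$i) a b (p2$i) (q2$i) i (bump t0 r) t"
  assumes ab: "\<forall>i. a$i < b$i"
    and kL1: "\<forall>i. k (1 - \<alpha>$i) absolutely_integrable_on {0<..<b$i - a$i}
              \<and> k (\<beta>$i) absolutely_integrable_on {0<..<b$i - a$i}"
    and \<Phi>: "\<And>x. x \<in> cbox a b \<times> UNIV \<Longrightarrow> (\<Phi> has_derivative blinfun_apply (\<Phi>' x)) (at x within cbox a b \<times> UNIV)"
    and \<Phi>': "continuous_on (cbox a b \<times> UNIV) \<Phi>'"
    and adm: "admissible k \<alpha> \<beta> a b p1 q1 p2 q2 \<psi> u"
    and extr: "(\<forall>y. admissible k \<alpha> \<beta> a b p1 q1 p2 q2 \<psi> y \<longrightarrow>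
                    Jfun F k \<alpha> \<beta> a b p1 q1 p2 q2 u \<le> Jfun F k \<alpha> \<beta> a b p1 q1 p2 q2 y)
             \<or> (\<forall>y. admissible k \<alpha> \<beta> a b p1 q1 p2 q2 \<psi> y \<longrightarrow>
                    Jfun F k \<alpha> \<beta> a b p1 q1 p2 q2 y \<le> Jfun F k \<alpha> \<beta> a b p1 q1 p2 q2 u)"
    and r: "r > 0" "cball t0 r \<subseteq> box a b"
  shows "integral (cbox a b)
           (\<lambda>t. \<Phi>' (z t) (0, axis kk (bump t0 r t), axis kk (BH t), axis kk (KH t))) = 0"
proof -
  define y where "y = (\<lambda>\<epsilon> t. u t + \<epsilon> *\<^sub>R axis kk (bump t0 r t))"
  define d where "d = (\<lambda>t. (0 :: real^'n, axis kk (bump t0 r t) :: real^'m, axis kk (BH t) :: real^'n^'m,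
    axis kk (KH t) :: real^'n^'m))"
  note cBK = variation_grad(1,2)[OF ab kL1 adm r, folded BH_def KH_def]
    and var = variation_grad(3-5)[OF ab kL1 adm r, where kk = kk]
  have cz: "continuous_on (cbox a b) z"
    unfolding z_def by (intro continuous_intros continuous_on_gradB_gradK[OF adm])
  have cd: "continuous_on (cbox a b) d"
    unfolding d_def by (intro continuous_intros continuous_on_axis cBK continuous_on_bump)
  \<comment> \<open>The direction \<open>d t\<close> has zero first component, so the perturbed
    argument stays in the domain of the Lagrangian for every real \<open>\<epsilon>\<close>.\<close>
  have mem: "z t + \<epsilon> *\<^sub>R d t \<in> cbox a b \<times> UNIV" if "t \<in> cbox a b" for t \<epsilon>
    using that by (simp add: z_def d_def)
  have lift: "lift F k \<alpha> \<beta> a b p1 q1 p2 q2 (y \<epsilon>) t = \<Phi> (z t + \<epsilon> *\<^sub>R d t)" if "t \<in> cbox a b" for t \<epsilon>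
    using that by (simp add: lift_def var(2,3) \<Phi>_def z_def d_def y_def BH_def KH_def)
  define I where "I = (\<lambda>\<epsilon>. integral (cbox a b) (\<lambda>t. \<Phi> (z t + \<epsilon> *\<^sub>R d t)))"
  have J: "Jfun F k \<alpha> \<beta> a b p1 q1 p2 q2 (y \<epsilon>) = I \<epsilon>" for \<epsilon>
    unfolding Jfun_def I_def integral_open_interval by (rule integral_cong) (rule lift)
  have adm_y: "admissible k \<alpha> \<beta> a b p1 q1 p2 q2 \<psi> (y \<epsilon>)" for \<epsilon>
    unfolding y_def by (rule var(1))
  have y0: "y 0 = u" by (simp add: y_def)
  have c\<Phi>: "continuous_on (cbox a b \<times> UNIV) \<Phi>"
    using \<Phi> by (rule has_derivative_continuous_on)
  have line: "continuous_on (S \<times> cbox a b) (\<lambda>x. z (snd x) + fst x *\<^sub>R d (snd x))" for S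
    by (intro continuous_intros continuous_on_compose2[OF cz] continuous_on_compose2[OF cd]) auto
  have "(I has_field_derivative integral (cbox a b) (\<lambda>t. \<Phi>' (z t + 0 *\<^sub>R d t) (d t))) (at 0 within UNIV)"
    unfolding I_def
  proof (rule leibniz_rule_field_derivative)
    show "((\<lambda>\<epsilon>. \<Phi> (z t + \<epsilon> *\<^sub>R d t)) has_field_derivative \<Phi>' (z t + \<epsilon> *\<^sub>R d t) (d t)) (at \<epsilon> within UNIV)"
      if "t \<in> cbox a b" for t \<epsilon>
      by (rule DERIV_along_line[OF \<Phi>[OF mem[OF that]] mem[OF that]])
    show "(\<lambda>t. \<Phi> (z t + \<epsilon> *\<^sub>R d t)) integrable_on cbox a b" for \<epsilon>
      by (intro integrable_continuous continuous_on_compose2[OF c\<Phi>] continuous_intros cz cd)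
        (use mem in blast)
    show "continuous_on (UNIV \<times> cbox a b) (\<lambda>(\<epsilon>, t). \<Phi>' (z t + \<epsilon> *\<^sub>R d t) (d t))"
      unfolding split_beta
      by (intro blinfun.continuous_on continuous_on_compose2[OF \<Phi>' line]
          continuous_on_compose2[OF cd continuous_on_snd[OF continuous_on_id]])
        (auto simp: image_subset_iff intro!: mem)
  qed auto
  then have der: "(I has_real_derivative integral (cbox a b) (\<lambda>t. \<Phi>' (z t) (d t))) (at 0)"
    by simp
  have "(\<forall>\<epsilon>. I 0 \<le> I \<epsilon>) \<or> (\<forall>\<epsilon>. I \<epsilon> \<le> I 0)"
    using extr adm_y J y0 by metis
  \<comment> \<open>The comparison with \<open>I 0\<close> holds for all \<open>\<epsilon>\<close>;
    the radius 1 is an arbitrary choice of neighbourhood.\<close>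
  then have "integral (cbox a b) (\<lambda>t. \<Phi>' (z t) (d t)) = 0"
    using DERIV_local_min[OF der zero_less_one] DERIV_local_max[OF der zero_less_one] by blast
  then show ?thesis by (simp add: d_def)
qed

section \<open>From the vanishing first variation to the pointwise Euler-Lagrange equation\<close>

theorem mainTheorem3:
  fixes F :: "real^'n \<Rightarrow> real^'m \<Rightarrow> real^'n^'m \<Rightarrow> real^'n^'m \<Rightarrow> real"
    and k :: "real \<Rightarrow> real \<Rightarrow> real"
    and \<alpha> \<beta> a b p1 q1 p2 q2 :: "real^'n"
    and \<psi> u :: "real^'n \<Rightarrow> real^'m"
  assumes ab: "\<forall>i. a$i < b$i"
    and \<alpha>01: "\<forall>i. 0 < \<alpha>$i \<and> \<alpha>$i < 1"
    and \<beta>01: "\<forall>i. 0 < \<beta>$i \<and> \<beta>$i < 1"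
    and kL1: "\<forall>i. k (1 - \<alpha>$i) absolutely_integrable_on {0<..<b$i - a$i}
              \<and> k (\<beta>$i) absolutely_integrable_on {0<..<b$i - a$i}"
    and FC2: "C2_on (cbox a b \<times> (UNIV :: ((real^'m) \<times> (real^'n^'m) \<times> (real^'n^'m)) set))
                (\<lambda>(t, x, v, w). F t x v w)"
    and adm: "admissible k \<alpha> \<beta> a b p1 q1 p2 q2 \<psi> u"
    and extr: "(\<forall>y. admissible k \<alpha> \<beta> a b p1 q1 p2 q2 \<psi> y \<longrightarrow>
                    Jfun F k \<alpha> \<beta> a b p1 q1 p2 q2 u \<le> Jfun F k \<alpha> \<beta> a b p1 q1 p2 q2 y)
             \<or> (\<forall>y. admissible k \<alpha> \<beta> a b p1 q1 p2 q2 \<psi> y \<longrightarrow>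
                    Jfun F k \<alpha> \<beta> a b p1 q1 p2 q2 y \<le> Jfun F k \<alpha> \<beta> a b p1 q1 p2 q2 u)"
    and R1: "\<forall>kk i. C1_on (cbox a b)
               (Kop k (1 - \<alpha>$i) a b (q1$i) (p1$i) i
                  (lift (dvF F kk i) k \<alpha> \<beta> a b p1 q1 p2 q2 u))"
    and R2: "\<forall>kk i. continuous_on (cbox a b)
               (Kop k (\<beta>$i) a b (q2$i) (p2$i) i
                  (lift (dwF F kk i) k \<alpha> \<beta> a b p1 q1 p2 q2 u))"
  shows "\<forall>kk. \<forall>t\<in>box a b.
           (\<Sum>i\<in>UNIV.
               - Aop k (\<alpha>$i) a b (q1$i) (p1$i) i (lift (dvF F kk i) k \<alpha> \<beta> a b p1 q1 p2 q2 u) t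
               + Kop k (\<beta>$i) a b (q2$i) (p2$i) i (lift (dwF F kk i) k \<alpha> \<beta> a b p1 q1 p2 q2 u) t)
           + lift (dxF F kk) k \<alpha> \<beta> a b p1 q1 p2 q2 u t = 0"
proof (intro allI ballI)
  fix kk t0
  assume t0: "t0 \<in> box a b"
  let ?T = "cbox a b \<times> (UNIV :: ((real^'m) \<times> (real^'n^'m) \<times> (real^'n^'m)) set)"
  let ?\<Phi> = "\<lambda>(t, x, v, w). F t x v w"
  let ?L = "\<lambda>G. lift G k \<alpha> \<beta> a b p1 q1 p2 q2 u"
  obtain \<Phi>' \<Phi>'' where \<Phi>: "\<And>x. x \<in> ?T \<Longrightarrow> (?\<Phi> has_derivative blinfun_apply (\<Phi>' x)) (at x within ?T)"
    and \<Phi>'': "\<And>x. x \<in> ?T \<Longrightarrow> (\<Phi>' has_derivative blinfun_apply (\<Phi>'' x)) (at x within ?T)"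
    using FC2 unfolding C2_on_def by blast
  have \<Phi>': "continuous_on ?T \<Phi>'"
    using \<Phi>'' by (rule has_derivative_continuous_on)
  define z where "z = (\<lambda>t. (t, u t, gradB k \<alpha> a b p1 q1 u t, gradK k \<beta> a b p2 q2 u t))"
  have cz: "continuous_on (cbox a b) z"
    unfolding z_def by (intro continuous_intros continuous_on_gradB_gradK[OF adm])
  have c\<Phi>z: "continuous_on (cbox a b) (\<lambda>t. \<Phi>' (z t) x)" for x
    by (intro continuous_intros continuous_on_compose2[OF \<Phi>' cz]) (auto simp: z_def)
  have Lx: "?L (dxF F kk) t = \<Phi>' (z t) (0, axis kk 1, 0, 0)"
    and Lv: "?L (dvF F kk i) t = \<Phi>' (z t) (0, 0, axis kk (axis i 1), 0)"
    and Lw: "?L (dwF F kk i) t = \<Phi>' (z t) (0, 0, 0, axis kk (axis i 1))" if "t \<in> cbox a b" for t i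
    unfolding lift_def z_def by (rule partials_eq_derivative[OF \<Phi>]; use that in simp)+
  have cx: "continuous_on (cbox a b) (?L (dxF F kk))"
    and cv: "continuous_on (cbox a b) (?L (dvF F kk i))"
    and cw: "continuous_on (cbox a b) (?L (dwF F kk i))" for i
    by (rule continuous_on_eq[OF c\<Phi>z]; simp add: Lx Lv Lw)+
  let ?A = "\<lambda>i. Aop k (\<alpha>$i) a b (q1$i) (p1$i) i (?L (dvF F kk i))"
  let ?KV = "\<lambda>i. Kop k (1 - \<alpha>$i) a b (q1$i) (p1$i) i (?L (dvF F kk i))"
  let ?KW = "\<lambda>i. Kop k (\<beta>$i) a b (q2$i) (p2$i) i (?L (dwF F kk i))"
  have "\<exists>G'. (\<forall>t\<in>cbox a b. (?KV i has_derivative blinfun_apply (G' t)) (at t within cbox a b)) \<and>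
      continuous_on (cbox a b) G'" for i
    using R1 unfolding C1_on_def by blast
  then obtain G' where G': "\<And>i t. t \<in> cbox a b \<Longrightarrow> (?KV i has_derivative blinfun_apply (G' i t)) (at t within cbox a b)"
      "\<And>i. continuous_on (cbox a b) (G' i)"
    by metis
  \<comment> \<open>The regularity assumption makes \<open>?KV i\<close> of class C^1, which
    identifies \<open>?A i\<close> on the box with the derivative \<open>G' i\<close> in direction
    \<open>axis i 1\<close>.\<close>
  have A: "?A i t = G' i t (axis i 1)" if "t \<in> cbox a b" for i t
    unfolding Aop_def using pd_eq[OF G'(1) that] that ab by blast
  have cKV: "continuous_on (cbox a b) (?KV i)" for i
    using G'(1) by (rule has_derivative_continuous_on)
  have cA: "continuous_on (cbox a b) (?A i)" for i
    by (rule continuous_on_eq[of _ "\<lambda>t. G' i t (axis i 1)"])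
      (auto simp: A intro!: continuous_intros G'(2))
  have cKW: "continuous_on (cbox a b) (?KW i)" for i using R2 by blast
  define E where "E = (\<lambda>t. (\<Sum>i\<in>UNIV. - ?A i t + ?KW i t) + ?L (dxF F kk) t)"
  have cE: "continuous_on (cbox a b) E"
    unfolding E_def by (intro continuous_intros cA cKW cx)
  have "E t0 = 0"
  proof (rule fundamental_lemma[OF cE t0])
    fix r :: real assume r: "r > 0" "cball t0 r \<subseteq> box a b"
    let ?\<eta> = "bump t0 r"
    let ?d = "\<lambda>i t. dbump t0 r t (axis i 1)"
    define BH where "BH = (\<lambda>t. \<chi> i. Kop k (1 - \<alpha>$i) a b (p1$i) (q1$i) i (?d i) t)"
    define KH where "KH = (\<lambda>t. \<chi> i. Kop k (\<beta>$i) a b (p2$i) (q2$i) i ?\<eta> t)"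
    note cBK = variation_grad(1,2)[OF ab kL1 adm r, folded BH_def KH_def]
    have cB: "continuous_on (cbox a b) (\<lambda>t. BH t $ i)" and cK: "continuous_on (cbox a b) (\<lambda>t. KH t $ i)" for i
      using cBK by (auto intro: continuous_intros)
    \<comment> \<open>Adjointness first moves the operator onto the \<open>v\<close> derivative of
      the Lagrangian with \<open>p1\<close> and \<open>q1\<close> exchanged; ordinary integration by
      parts then frees the bump and produces the minus sign.\<close>
    have IB: "integral (cbox a b) (\<lambda>t. ?L (dvF F kk i) t * BH t $ i) = - integral (cbox a b) (\<lambda>t. ?A i t * ?\<eta> t)" for i
    proof -
      have "integral (cbox a b) (\<lambda>t. ?L (dvF F kk i) t * BH t $ i) = integral (cbox a b) (\<lambda>t. ?KV i t * ?d i t)"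
        unfolding BH_def vec_lambda_beta
        by (rule Kop_adjoint) (use kL1 cv cKV cB[of i] in \<open>auto simp: continuous_on_dbump BH_def\<close>)
      also have "\<dots> = - integral (cbox a b) (\<lambda>t. G' i t (axis i 1) * ?\<eta> t)"
        by (rule integral_by_parts_bump[OF G' r])
      also have "integral (cbox a b) (\<lambda>t. G' i t (axis i 1) * ?\<eta> t) = integral (cbox a b) (\<lambda>t. ?A i t * ?\<eta> t)"
        by (rule integral_cong) (simp add: A)
      finally show ?thesis .
    qed
    have IK: "integral (cbox a b) (\<lambda>t. ?L (dwF F kk i) t * KH t $ i) = integral (cbox a b) (\<lambda>t. ?KW i t * ?\<eta> t)" for i
      unfolding KH_def vec_lambda_beta
      by (rule Kop_adjoint) (use kL1 cw cKW cK[of i] in \<open>auto simp: continuous_on_bump KH_def\<close>)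
    note int = integrable_continuous[OF continuous_on_mult]
    have "0 = integral (cbox a b) (\<lambda>t. \<Phi>' (z t) (0, axis kk (?\<eta> t), axis kk (BH t), axis kk (KH t)))"
      unfolding z_def BH_def KH_def
      by (rule first_variation_eq_0[OF ab kL1 \<Phi> \<Phi>' adm extr r, symmetric])
    also have "\<dots> = integral (cbox a b) (\<lambda>t. ?L (dxF F kk) t * ?\<eta> t
        + (\<Sum>i\<in>UNIV. ?L (dvF F kk i) t * BH t $ i) + (\<Sum>i\<in>UNIV. ?L (dwF F kk i) t * KH t $ i))"
      \<comment> \<open>The bump occurs only in component \<open>kk\<close>, so only partial
        derivatives with that row index survive.\<close>
      by (rule integral_cong) (simp add: blinfun_apply_row Lx Lv Lw mult.commute)
    also have "\<dots> = integral (cbox a b) (\<lambda>t. ?L (dxF F kk) t * ?\<eta> t)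
        + (\<Sum>i\<in>UNIV. integral (cbox a b) (\<lambda>t. ?L (dvF F kk i) t * BH t $ i))
        + (\<Sum>i\<in>UNIV. integral (cbox a b) (\<lambda>t. ?L (dwF F kk i) t * KH t $ i))"
      by (simp add: integral_add integral_sum integrable_add integrable_sum int cx cv cw cB cK continuous_on_bump)
    also have "\<dots> = integral (cbox a b) (\<lambda>t. ?L (dxF F kk) t * ?\<eta> t)
        + (\<Sum>i\<in>UNIV. - integral (cbox a b) (\<lambda>t. ?A i t * ?\<eta> t))
        + (\<Sum>i\<in>UNIV. integral (cbox a b) (\<lambda>t. ?KW i t * ?\<eta> t))"
      by (simp only: IB IK)
    also have "\<dots> = integral (cbox a b) (\<lambda>t. ?L (dxF F kk) t * ?\<eta> t
        + (\<Sum>i\<in>UNIV. - (?A i t * ?\<eta> t)) + (\<Sum>i\<in>UNIV. ?KW i t * ?\<eta> t))"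
      by (simp add: integral_add integral_sum integrable_add integrable_sum int cx cA cKW continuous_on_bump
          integral_neg integrable_neg del: sum_negf)
    \<comment> \<open>Every term now carries the undifferentiated bump as a factor, and the
      remaining factors add up to \<open>E\<close>.\<close>
    also have "\<dots> = integral (cbox a b) (\<lambda>t. E t * ?\<eta> t)"
      unfolding E_def
      by (rule integral_cong) (simp add: distrib_right left_diff_distrib sum_distrib_right sum_subtractf sum_negf)
    finally show "integral (cbox a b) (\<lambda>t. E t * ?\<eta> t) = 0" by simp
  qed
  then show "(\<Sum>i\<in>UNIV. - ?A i t0 + ?KW i t0) + ?L (dxF F kk) t0 = 0"
    by (simp add: E_def)
qed

end
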